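(* Suppose that assumptions (H1), (H2) and (H3) stated in the context hold and let $p\in[1,+\infty]$. Endow the linear spaces $X$ and $Y:=\{y\in X:y(z)=0,\ z\in\partial G\}$ with the norm $\|\cdot\|_p$. Consider the boundary-input problem $$\text{(BI)}\quad (Lx)(t,z)=0\ \text{ on }(0,+\infty)\times G,\quad x(0,z)=x_0(z)\ \text{ on }G,\quad x(t,z)=u(t,z)\ \text{ on }\mathbb{R}_+\times\partial G,$$ and the distributed-input problem $$\text{(DI)}\quad \frac{\partial y}{\partial t}(t,z)-\sum_{i,j=1}^na_{i,j}(z)\frac{\partial^2y}{\partial z_i\partial z_j}(t,z)-f\big(z,y(t,z)+v(t,z),\nabla y(t,z)\big)=0\ \text{ for } t>0,\ z\in G,\qquad y(t,z)=0\ \text{ for } z\in\partial G,\ t\ge0.$$ The following statements are equivalent: (i) The system (BI) with the state space $X$ is exp-ISS with respect to inputs of class $\mathcal{U}$. (ii) The system (BI) with the state space $X$ is exp-ISS with respect to the constant in time inputs of class $\mathcal{U}$. (iii) The system (DI) with the state space $Y$ is exp-ISS with respect to inputs in $\mathcal{V}$.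
   Context: Setting. $\mathbb{R}_+=[0,\infty)$; $G\subset\mathbb{R}^n$ is an open bounded region; $CL$ is the class of functions $x\in C^0(\mathbb{R}_+\times\overline{G})\cap C^{1,2}((0,+\infty)\times G)$, where $C^{1,2}$ means continuously differentiable in $t$ with continuous second derivatives in $z$. For $x\in CL$, $$(Lx)(t,z):=\frac{\partial x}{\partial t}(t,z)-\sum_{i,j=1}^n a_{i,j}(z)\frac{\partial^2x}{\partial z_i\partial z_j}(t,z)-f\big(z,x(t,z),\nabla x(t,z)\big),$$ with $a_{i,j}\in C^0(\overline{G})$ and $f\in C^0(\overline{G}\times\mathbb{R}\times\mathbb{R}^n)$. $L$ is assumed uniformly parabolic: there is $K>0$ with $\sum_{i,j}a_{i,j}(z)\xi_i\xi_j\ge K|\xi|^2$ for all $\xi\in\mathbb{R}^n$, $z\in\overline{G}$. Inputs. $U=C^0(\partial G)$ with the sup-norm, $\mathcal{U}:=\{u\in C^0(\mathbb{R}_+;U): u \text{ bounded}\}$ with $\|u\|_{\mathcal{U}}=\sup_{t\ge0,\,z\in\partial G}|u(t,z)|$. A constant in time input is $u\in\mathcal{U}$ with $u(t,z)=u(0,z)$ for all $(t,z)\in\mathbb{R}_+\times\partial G$. $\mathcal{V}:=\{v\in C^0(\mathbb{R}_+\times\overline{G},\mathbb{R}):\exists k\in\mathbb{R}:\ v(t,z)=k\ \forall(t,z)\in\mathbb{R}_+\times\overline{G}\}$ with the sup-norm. $\|x\|_p=(\int_G|x(z)|^pdz)^{1/p}$ for $p<\infty$, and $\|x\|_\infty$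 is the (essential) supremum of $|x|$ over $G$. (H1) There is a linear space $X\subseteq C^0(\overline{G})$ containing all constant functions, and for each $x_0\in X$ a nonempty set of (admissible) inputs $\mathcal{U}(x_0)\subseteq\{v\in\mathcal{U}: v(0,z)=x_0(z)\text{ for }z\in\partial G\}$, such that: if $x_0\in X$ is constant on $\partial G$, then $\mathcal{U}(x_0)$ contains the input $v$ given by $v(t,z)=x_0(z)$ for $z\in\partial G$, $t\ge0$; and for every $x_0\in X$, $u\in\mathcal{U}(x_0)$ there exists a solution $x\in CL$ of (BI) with $x[t]:=x(t,\cdot)\in X$ for all $t\ge0$. The sets of admissible inputs are compatible with time shifts: $u(t+\cdot)\in\mathcal{U}(x[t])$ for all $t\ge0$, $x_0\in X$, $u\in\mathcal{U}(x_0)$. (H2) For every bounded set $W\subset\mathbb{R}$ there is $k>0$ such that $f(z,w_1,\xi)-f(z,w_2,\xi)<k(w_1-w_2)$ for all $w_1,w_2\in W$ with $w_1>w_2$, $z\in G$, $\xi\in\mathbb{R}^n$. Moreover, $(z,w,\xi)\mapsto f(z,w,\xi)$ on $\overline{G}\times\mathbb{R}\times\mathbb{R}^n$ is continuously differentiable with respect to $w\in\mathbb{R}$ and $\xi\in\mathbb{R}^n$. (H3) For every $\delta>0$, $a\in\mathbb{R}$, $x\in X$ there is a continuous function $k:\overline{G}\to[0,1]$ with $k(z)=1$ for $z\in\partial G$, $k(z)=0$ for all $z\in G$ whose Euclidean distance to $\partial G$ is at least $\delta$, and such that the function $z\mapsto(1-k(z))x(z)+a\,k(z)$ belongs to $X$.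 Solution maps. $\phi(t,x_0,u):=x[t]$ denotes the state at time $t$ of the solution $x\in CL$ of (BI) for $x_0\in X$, $u\in\mathcal{U}(x_0)$. $\phi_y(t,y_0,v)$ denotes the state at time $t$ of the solution (in $CL$) of (DI) with initial condition $y_0\in Y$ and input $v\in\mathcal{V}$ (all $v\in\mathcal{V}$ are admissible for all $y_0\in Y$); one has $\phi_y(t,y_0,v)=\phi(t,x,v|_{\partial G})-v$ with $x=y_0+v$. exp-ISS. $\mathcal{K}_\infty$ is the set of continuous, strictly increasing, unbounded $\gamma:\mathbb{R}_+\to\mathbb{R}_+$ with $\gamma(0)=0$. A system with state space $X$, admissible input sets $\mathcal{U}(x)$ and transition map $\phi$ is exp-ISS with respect to inputs in a set $\mathcal{W}$ if there exist constants $M,\lambda>0$ and $\gamma\in\mathcal{K}_\infty$ such that for every $x\in X$ with $\mathcal{U}(x)\cap\mathcal{W}\ne\emptyset$, all $u\in\mathcal{U}(x)\cap\mathcal{W}$ and all $t\ge0$: $\|\phi(t,x,u)\|\le Me^{-\lambda t}\|x\|+\gamma(\|u\|)$, where states are measured in the norm of the state space and inputs in the norm of the input space. *)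

theory Defs
  imports "HOL-Analysis.Analysis" "HOL-Probability.Essential_Supremum"
begin

text \<open>
  Real functions on a set S are total HOL functions that are extensional on S, so that two of
  them are equal iff they agree on S. Functions of time and space are curried and extensional in
  both arguments; thus \<open>x t\<close> is literally the profile \<open>x[t]\<close>.
\<close>

type_synonym 'n profile = "real^'n \<Rightarrow> real"
type_synonym 'n evolution = "real \<Rightarrow> real^'n \<Rightarrow> real"

definition C0 :: "(real^'n) set \<Rightarrow> 'n::finite profile set" where
  "C0 S = {g \<in> extensional S. continuous_on S g}"


subsection \<open>Partial derivatives and the class CL\<close>

definition has_partial :: "'n::finite \<Rightarrow> 'n profile \<Rightarrow> real^'n \<Rightarrow> bool" where
  "has_partial i g z \<longleftrightarrow> (\<lambda>h. g (z + h *\<^sub>R axis i 1)) differentiable (at 0)"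

definition partial :: "'n::finite \<Rightarrow> 'n profile \<Rightarrow> real^'n \<Rightarrow> real" where
  "partial i g z = deriv (\<lambda>h. g (z + h *\<^sub>R axis i 1)) 0"

definition grad :: "'n::finite profile \<Rightarrow> real^'n \<Rightarrow> real^'n" where
  "grad g z = (\<chi> i. partial i g z)"

definition C12 :: "(real^'n) set \<Rightarrow> 'n::finite evolution \<Rightarrow> bool" where
  "C12 G x \<longleftrightarrow>
     (\<forall>t>0. \<forall>z\<in>G. (\<lambda>s. x s z) differentiable (at t)) \<and>
     continuous_on ({0<..} \<times> G) (\<lambda>(t, z). deriv (\<lambda>s. x s z) t) \<and>
     (\<forall>i. (\<forall>t>0. \<forall>z\<in>G. has_partial i (x t) z) \<and>
          continuous_on ({0<..} \<times> G) (\<lambda>(t, z). partial i (x t) z)) \<and>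
     (\<forall>i j. (\<forall>t>0. \<forall>z\<in>G. has_partial i (partial j (x t)) z) \<and>
            continuous_on ({0<..} \<times> G) (\<lambda>(t, z). partial i (partial j (x t)) z))"

definition CL :: "(real^'n) set \<Rightarrow> 'n::finite evolution set" where
  "CL G = {x \<in> {0..} \<rightarrow>\<^sub>E extensional (closure G).
             continuous_on ({0..} \<times> closure G) (\<lambda>(t, z). x t z) \<and> C12 G x}"


subsection \<open>The parabolic operator and the two initial-boundary value problems\<close>

definition uniformly_parabolic :: "(real^'n) set \<Rightarrow> (real^'n \<Rightarrow> real^'n::finite^'n) \<Rightarrow> bool" where
  "uniformly_parabolic G a \<longleftrightarrow>
     (\<exists>K>0. \<forall>z\<in>closure G. \<forall>\<xi>::real^'n.
        (\<Sum>i\<in>UNIV. \<Sum>j\<in>UNIV. a z $ i $ j * \<xi> $ i * \<xi> $ j) \<ge> K * (norm \<xi>)\<^sup>2)"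

definition second_order ::
    "(real^'n \<Rightarrow> real^'n^'n) \<Rightarrow> 'n::finite profile \<Rightarrow> real^'n \<Rightarrow> real" where
  "second_order a g z = (\<Sum>i\<in>UNIV. \<Sum>j\<in>UNIV. a z $ i $ j * partial i (partial j g) z)"

definition L_op :: "(real^'n \<Rightarrow> real^'n^'n) \<Rightarrow> (real^'n \<Rightarrow> real \<Rightarrow> real^'n \<Rightarrow> real) \<Rightarrow>
    'n::finite evolution \<Rightarrow> 'n evolution" where
  "L_op a f x t z =
     deriv (\<lambda>s. x s z) t - second_order a (x t) z - f z (x t z) (grad (x t) z)"

definition BI_solution :: "(real^'n) set \<Rightarrow> (real^'n \<Rightarrow> real^'n^'n) \<Rightarrow>
    (real^'n \<Rightarrow> real \<Rightarrow> real^'n \<Rightarrow> real) \<Rightarrow>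
    'n::finite profile \<Rightarrow> 'n evolution \<Rightarrow> 'n evolution \<Rightarrow> bool" where
  "BI_solution G a f x0 u x \<longleftrightarrow>
     x \<in> CL G \<and>
     (\<forall>t>0. \<forall>z\<in>G. L_op a f x t z = 0) \<and>
     (\<forall>z\<in>G. x 0 z = x0 z) \<and>
     (\<forall>t\<ge>0. \<forall>z\<in>frontier G. x t z = u t z)"

definition DI_solution :: "(real^'n) set \<Rightarrow> (real^'n \<Rightarrow> real^'n^'n) \<Rightarrow>
    (real^'n \<Rightarrow> real \<Rightarrow> real^'n \<Rightarrow> real) \<Rightarrow>
    'n::finite profile \<Rightarrow> 'n evolution \<Rightarrow> 'n evolution \<Rightarrow> bool" where
  "DI_solution G a f y0 v y \<longleftrightarrow>
     y \<in> CL G \<and>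
     (\<forall>t>0. \<forall>z\<in>G. deriv (\<lambda>s. y s z) t - second_order a (y t) z
                     - f z (y t z + v t z) (grad (y t) z) = 0) \<and>
     (\<forall>z\<in>G. y 0 z = y0 z) \<and>
     (\<forall>t\<ge>0. \<forall>z\<in>frontier G. y t z = 0)"

text \<open>
  The transition maps pick out the unique solution in CL. Uniqueness is a consequence of parabolicity
  and of the one-sided Lipschitz condition in \<open>H2\<close> (maximum principle).
\<close>

definition BI_flow :: "(real^'n) set \<Rightarrow> (real^'n \<Rightarrow> real^'n^'n) \<Rightarrow>
    (real^'n \<Rightarrow> real \<Rightarrow> real^'n \<Rightarrow> real) \<Rightarrow>
    real \<Rightarrow> 'n::finite profile \<Rightarrow> 'n evolution \<Rightarrow> 'n profile" where
  "BI_flow G a f t x0 u = (THE x. BI_solution G a f x0 u x) t"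

definition DI_flow :: "(real^'n) set \<Rightarrow> (real^'n \<Rightarrow> real^'n^'n) \<Rightarrow>
    (real^'n \<Rightarrow> real \<Rightarrow> real^'n \<Rightarrow> real) \<Rightarrow>
    real \<Rightarrow> 'n::finite profile \<Rightarrow> 'n evolution \<Rightarrow> 'n profile" where
  "DI_flow G a f t y0 v = (THE y. DI_solution G a f y0 v y) t"


subsection \<open>Inputs and norms\<close>

text \<open>
  Continuity of \<open>u\<close> as a map into \<open>C0 (frontier G)\<close> with the sup-norm is convergence of \<open>u s\<close> to
  \<open>u t\<close> uniformly on \<open>frontier G\<close> as \<open>s\<close> tends to \<open>t\<close>.
\<close>

definition boundary_inputs :: "(real^'n) set \<Rightarrow> 'n::finite evolution set" where
  "boundary_inputs G = {u \<in> {0..} \<rightarrow>\<^sub>E C0 (frontier G).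
     (\<forall>t\<ge>0. uniform_limit (frontier G) u (u t) (at t within {0..})) \<and>
     (\<exists>B. \<forall>t\<ge>0. \<forall>z\<in>frontier G. \<bar>u t z\<bar> \<le> B)}"

definition constant_in_time :: "(real^'n) set \<Rightarrow> 'n::finite evolution set" where
  "constant_in_time G = {u \<in> boundary_inputs G. \<forall>t\<ge>0. \<forall>z\<in>frontier G. u t z = u 0 z}"

definition distributed_inputs :: "(real^'n) set \<Rightarrow> 'n::finite evolution set" where
  "distributed_inputs G = {v \<in> {0..} \<rightarrow>\<^sub>E extensional (closure G).
     continuous_on ({0..} \<times> closure G) (\<lambda>(t, z). v t z) \<and>
     (\<exists>k. \<forall>t\<ge>0. \<forall>z\<in>closure G. v t z = k)}"

definition input_norm :: "(real^'n) set \<Rightarrow> 'n::finite evolution \<Rightarrow> real" where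
  "input_norm S u = (SUP (t, z)\<in>{0..} \<times> S. \<bar>u t z\<bar>)"

definition Lp_norm :: "ereal \<Rightarrow> (real^'n) set \<Rightarrow> 'n::finite profile \<Rightarrow> real" where
  "Lp_norm p G g =
     (if p = \<infinity> then real_of_ereal (esssup (lebesgue_on G) (\<lambda>z. ereal \<bar>g z\<bar>))
      else (LINT z|lebesgue_on G. \<bar>g z\<bar> powr real_of_ereal p) powr (1 / real_of_ereal p))"


subsection \<open>Standing hypotheses\<close>

definition linear_space :: "(real^'n) set \<Rightarrow> 'n::finite profile set \<Rightarrow> bool" where
  "linear_space S X \<longleftrightarrow>
     X \<subseteq> extensional S \<and>
     (\<lambda>z\<in>S. 0) \<in> X \<and>
     (\<forall>g\<in>X. \<forall>h\<in>X. (\<lambda>z\<in>S. g z + h z) \<in> X) \<and>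
     (\<forall>c. \<forall>g\<in>X. (\<lambda>z\<in>S. c * g z) \<in> X)"

definition H1 :: "(real^'n) set \<Rightarrow> (real^'n \<Rightarrow> real^'n^'n) \<Rightarrow>
    (real^'n \<Rightarrow> real \<Rightarrow> real^'n \<Rightarrow> real) \<Rightarrow>
    'n::finite profile set \<Rightarrow> ('n profile \<Rightarrow> 'n evolution set) \<Rightarrow> bool" where
  "H1 G a f X Uad \<longleftrightarrow>
     linear_space (closure G) X \<and> X \<subseteq> C0 (closure G) \<and>
     (\<forall>c. (\<lambda>z\<in>closure G. c) \<in> X) \<and>
     (\<forall>x0\<in>X. Uad x0 \<noteq> {} \<and>
        Uad x0 \<subseteq> {v \<in> boundary_inputs G. \<forall>z\<in>frontier G. v 0 z = x0 z}) \<and>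
     (\<forall>x0\<in>X. (\<exists>c. \<forall>z\<in>frontier G. x0 z = c) \<longrightarrow>
        (\<lambda>t\<in>{0..}. \<lambda>z\<in>frontier G. x0 z) \<in> Uad x0) \<and>
     (\<forall>x0\<in>X. \<forall>u\<in>Uad x0. \<exists>x. BI_solution G a f x0 u x \<and>
        (\<forall>t\<ge>0. x t \<in> X \<and> (\<lambda>s\<in>{0..}. u (t + s)) \<in> Uad (x t)))"

definition H2 :: "(real^'n) set \<Rightarrow> (real^'n \<Rightarrow> real \<Rightarrow> real^'n::finite \<Rightarrow> real) \<Rightarrow> bool" where
  "H2 G f \<longleftrightarrow>
     (\<forall>W. bounded W \<longrightarrow> (\<exists>k>0. \<forall>w1\<in>W. \<forall>w2\<in>W. w1 > w2 \<longrightarrow>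
        (\<forall>z\<in>G. \<forall>\<xi>. f z w1 \<xi> - f z w2 \<xi> < k * (w1 - w2)))) \<and>
     (\<forall>z\<in>closure G. \<forall>w \<xi>. (\<lambda>s. f z s \<xi>) differentiable (at w)) \<and>
     continuous_on (closure G \<times> UNIV \<times> UNIV) (\<lambda>(z, w, \<xi>). deriv (\<lambda>s. f z s \<xi>) w) \<and>
     (\<forall>i. (\<forall>z\<in>closure G. \<forall>w \<xi>. has_partial i (f z w) \<xi>) \<and>
          continuous_on (closure G \<times> UNIV \<times> UNIV) (\<lambda>(z, w, \<xi>). partial i (f z w) \<xi>))"

definition H3 :: "(real^'n) set \<Rightarrow> 'n::finite profile set \<Rightarrow> bool" where
  "H3 G X \<longleftrightarrow>
     (\<forall>\<delta>>0. \<forall>c. \<forall>x\<in>X. \<exists>k. continuous_on (closure G) k \<and> k \<in> closure G \<rightarrow> {0..1} \<and>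
        (\<forall>z\<in>frontier G. k z = 1) \<and>
        (\<forall>z\<in>G. infdist z (frontier G) \<ge> \<delta> \<longrightarrow> k z = 0) \<and>
        (\<lambda>z\<in>closure G. (1 - k z) * x z + c * k z) \<in> X)"

definition zero_boundary :: "(real^'n) set \<Rightarrow> 'n::finite profile set \<Rightarrow> 'n profile set" where
  "zero_boundary G X = {y \<in> X. \<forall>z\<in>frontier G. y z = 0}"


subsection \<open>Exponential input-to-state stability\<close>

definition class_K_inf :: "(real \<Rightarrow> real) set" where
  "class_K_inf = {\<gamma> \<in> {0..} \<rightarrow> {0..}. continuous_on {0..} \<gamma> \<and> strict_mono_on {0..} \<gamma> \<and>
     \<not> bounded (\<gamma> ` {0..}) \<and> \<gamma> 0 = 0}"

definition exp_ISS :: "('s \<Rightarrow> real) \<Rightarrow> ('u \<Rightarrow> real) \<Rightarrow> 's set \<Rightarrow> ('s \<Rightarrow> 'u set) \<Rightarrow>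
    (real \<Rightarrow> 's \<Rightarrow> 'u \<Rightarrow> 's) \<Rightarrow> 'u set \<Rightarrow> bool" where
  "exp_ISS state_norm inp_norm X Uad \<phi> W \<longleftrightarrow>
     (\<exists>M>0. \<exists>lam>0. \<exists>\<gamma>\<in>class_K_inf.
        \<forall>x\<in>X. Uad x \<inter> W \<noteq> {} \<longrightarrow>
          (\<forall>u\<in>Uad x \<inter> W. \<forall>t\<ge>0.
             state_norm (\<phi> t x u) \<le> M * exp (- lam * t) * state_norm x + \<gamma> (inp_norm u)))"

definition BI_exp_ISS :: "ereal \<Rightarrow> (real^'n) set \<Rightarrow> (real^'n \<Rightarrow> real^'n^'n) \<Rightarrow>
    (real^'n \<Rightarrow> real \<Rightarrow> real^'n \<Rightarrow> real) \<Rightarrow> 'n::finite profile set \<Rightarrow>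
    ('n profile \<Rightarrow> 'n evolution set) \<Rightarrow> 'n evolution set \<Rightarrow> bool" where
  "BI_exp_ISS p G a f X Uad W \<longleftrightarrow>
     exp_ISS (Lp_norm p G) (input_norm (frontier G)) X Uad (BI_flow G a f) W"

definition DI_exp_ISS :: "ereal \<Rightarrow> (real^'n) set \<Rightarrow> (real^'n \<Rightarrow> real^'n^'n) \<Rightarrow>
    (real^'n \<Rightarrow> real \<Rightarrow> real^'n \<Rightarrow> real) \<Rightarrow> 'n::finite profile set \<Rightarrow> 'n evolution set \<Rightarrow> bool" where
  "DI_exp_ISS p G a f Y V \<longleftrightarrow>
     exp_ISS (Lp_norm p G) (input_norm (closure G)) Y (\<lambda>y0. V) (DI_flow G a f) V"

end

theory Submission
  imports Defs
begin

text \<open>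
  The three properties are compared with an intermediate one: the exponential estimate for boundary
  values that are constant both in time and in space (\<open>steady_exp_ISS\<close>).

  For such a boundary value \<open>c\<close> the two problems differ by a translation. If \<open>x\<close> solves (BI) with
  boundary value \<open>c\<close>, then \<open>y = x - c\<close> vanishes on the boundary, has the same derivatives, and solves
  (DI) with \<open>v = c\<close>, because \<open>x = y + v\<close> in the nonlinearity. Since the norm of a constant is
  proportional to its modulus, the estimate passes from one problem to the other with a larger gain
  (\<open>DI_if_steady\<close>, \<open>steady_if_DI\<close>).

  To pass from steady boundary values to arbitrary bounded inputs \<open>u\<close>, let \<open>B = \<parallel>u\<parallel>\<close>. Hypothesis
  \<open>H3\<close> lets the initial state be modified near the boundary into states \<open>w\<close> and \<open>w'\<close> of \<open>X\<close> with
  \<open>w' \<le> x0 \<le> w\<close> whose boundary values are the constants \<open>\<plusminus>(B + \<epsilon>)\<close>; the margin \<open>\<epsilon>\<close> is what makes the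
  order hold near the boundary, by uniform continuity of \<open>x0\<close>. By the comparison principle the
  solution for \<open>u\<close> stays between the two solutions with steady boundary values, so its norm is bounded
  by theirs, and \<open>\<epsilon>\<close> tends to 0 at the end (\<open>boundary_if_steady\<close>). Inputs constant in time may still
  vary along the boundary, so even for them this sandwich is needed.

  The comparison principle also gives uniqueness, and thereby identifies the transition maps with the
  solutions. It is proved by looking at a maximum of \<open>exp (- k * t) * (x - y)\<close>: there the gradients
  agree, the second-order term is nonpositive, and the one-sided Lipschitz condition in \<open>H2\<close> contradicts
  the sign of the time derivative. The sign of the second-order term needs the mixed partial
  derivatives to commute, since the coefficient matrix need not be symmetric, and the fact that the
  trace of a positive times a negative semidefinite matrix is nonpositive.
\<close>

section \<open>Products of positive and negative semidefinite forms\<close>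

lemma quadratic_form_shift:
  fixes A :: "'n::finite \<Rightarrow> 'n \<Rightarrow> real"
  assumes sym: "\<And>i j. A i j = A j i"
  shows "(\<Sum>i\<in>UNIV. \<Sum>j\<in>UNIV. A i j * (\<xi> i + (if i = k then s else 0)) * (\<xi> j + (if j = k then s else 0)))
    = (\<Sum>i\<in>UNIV. \<Sum>j\<in>UNIV. A i j * \<xi> i * \<xi> j) + 2 * s * (\<Sum>j\<in>UNIV. A k j * \<xi> j) + s\<^sup>2 * A k k"
proof -
  have "(\<Sum>i\<in>UNIV. \<Sum>j\<in>UNIV. A i j * (\<xi> i + (if i = k then s else 0)) * (\<xi> j + (if j = k then s else 0)))
    = (\<Sum>i\<in>UNIV. \<Sum>j\<in>UNIV. A i j * \<xi> i * \<xi> j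
        + (if j = k then s * (A i k * \<xi> i) else 0)
        + (if i = k then s * (A k j * \<xi> j) else 0)
        + (if i = k then (if j = k then s\<^sup>2 * A k k else 0) else 0))"
    by (intro sum.cong refl) (auto simp: algebra_simps power2_eq_square)
  also have "\<dots> = (\<Sum>i\<in>UNIV. \<Sum>j\<in>UNIV. A i j * \<xi> i * \<xi> j)
      + (\<Sum>i\<in>UNIV. s * (A i k * \<xi> i))
      + (\<Sum>i\<in>UNIV. \<Sum>j\<in>UNIV. (if i = k then s * (A k j * \<xi> j) else 0))
      + (\<Sum>i\<in>UNIV. \<Sum>j\<in>UNIV. (if i = k then (if j = k then s\<^sup>2 * A k k else 0) else 0))"
    by (simp add: sum.distrib)
  also have "(\<Sum>i\<in>UNIV. \<Sum>j\<in>UNIV. (if i = k then s * (A k j * \<xi> j) else 0)) = (\<Sum>j\<in>UNIV. s * (A k j * \<xi> j))"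
    by (subst sum.swap) simp
  also have "(\<Sum>i\<in>UNIV. \<Sum>j\<in>UNIV. (if i = k then (if j = k then s\<^sup>2 * A k k else 0) else 0)) = s\<^sup>2 * A k k"
    by (subst sum.swap) simp
  also have "(\<Sum>i\<in>UNIV. s * (A i k * \<xi> i)) = (\<Sum>j\<in>UNIV. s * (A k j * \<xi> j))"
    using sym by metis
  finally show ?thesis by (simp add: sum_distrib_left mult.assoc)
qed

text \<open>
  No spectral theorem is used. As in a Cholesky factorization, one index \<open>k\<close> at a time is eliminated
  by splitting off the rank-one form \<open>v v\<^sup>T / A k k\<close> with \<open>v = A k\<close>. The remaining Schur complement is
  again positive semidefinite, being the minimum of the form of \<open>A\<close> over the \<open>k\<close>-th coordinate, and
  each rank-one piece contributes a value of the form of \<open>H\<close>.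
\<close>

lemma sum_product_nonpos_symmetric:
  fixes A H :: "'n::finite \<Rightarrow> 'n \<Rightarrow> real"
  assumes H: "\<And>\<xi>. (\<Sum>i\<in>UNIV. \<Sum>j\<in>UNIV. H i j * \<xi> i * \<xi> j) \<le> 0"
    and "finite S"
    and "\<And>i j. A i j = A j i"
    and "\<And>i j. i \<notin> S \<Longrightarrow> A i j = 0"
    and "\<And>\<xi>. 0 \<le> (\<Sum>i\<in>UNIV. \<Sum>j\<in>UNIV. A i j * \<xi> i * \<xi> j)"
  shows "(\<Sum>i\<in>UNIV. \<Sum>j\<in>UNIV. A i j * H i j) \<le> 0"
  using assms(2-)
proof (induction S arbitrary: A rule: finite_induct)
  case empty
  then show ?case by simp
next
  case (insert k S)
  note sym = insert.prems(1) and supp = insert.prems(2) and psd = insert.prems(3)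
  define b where "b \<xi> = (\<Sum>j\<in>UNIV. A k j * \<xi> j)" for \<xi>
  have shift: "0 \<le> (\<Sum>i\<in>UNIV. \<Sum>j\<in>UNIV. A i j * \<xi> i * \<xi> j) + 2 * s * b \<xi> + s\<^sup>2 * A k k" for \<xi> s
    using psd[of "\<lambda>i. \<xi> i + (if i = k then s else 0)"] quadratic_form_shift[of A \<xi> k s, OF sym]
    by (simp add: b_def)
  have diag: "0 \<le> A k k" using shift[of "\<lambda>_. 0" 1] by (simp add: b_def)
  show ?case
  proof (cases "A k k = 0")
    case True
    \<comment> \<open>With a zero diagonal entry the form is affine in the k-th coordinate and nonnegative, hence constant in it.\<close>
    have "A k j = 0" for j
    proof (rule ccontr)
      assume ne: "A k j \<noteq> 0"
      define Q where "Q = (\<Sum>i\<in>UNIV. \<Sum>j'\<in>UNIV. A i j' * of_bool (i = j) * of_bool (j' = j))"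
      have "b (\<lambda>i. of_bool (i = j)) = A k j" by (simp add: b_def)
      then have "0 \<le> Q + 2 * s * A k j" for s
        using shift[of "\<lambda>i. of_bool (i = j)" s] True by (simp add: Q_def)
      from this[of "- (Q + 1) / (2 * A k j)"] ne show False by (simp add: field_simps)
    qed
    then have "A i j = 0" if "i \<notin> S" for i j using that supp[of i j] by (cases "i = k") auto
    then show ?thesis using insert.IH[OF sym _ psd] by blast
  next
    case False
    then have pos: "A k k > 0" using diag by simp
    define A' where "A' i j = A i j - A k i * A k j / A k k" for i j
    have sq: "(\<Sum>i\<in>UNIV. \<Sum>j\<in>UNIV. A k i * A k j / A k k * (F i j)) =
        (1 / A k k) * (\<Sum>i\<in>UNIV. \<Sum>j\<in>UNIV. F i j * A k i * A k j)" for F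
      by (simp only: sum_distrib_left) (intro sum.cong refl, simp)
    have "0 \<le> (\<Sum>i\<in>UNIV. \<Sum>j\<in>UNIV. A' i j * \<xi> i * \<xi> j)" for \<xi>
    proof -
      have "(\<Sum>i\<in>UNIV. \<Sum>j\<in>UNIV. A' i j * \<xi> i * \<xi> j) =
         (\<Sum>i\<in>UNIV. \<Sum>j\<in>UNIV. A i j * \<xi> i * \<xi> j)
         - (\<Sum>i\<in>UNIV. \<Sum>j\<in>UNIV. A k i * A k j / A k k * (\<xi> i * \<xi> j))"
        by (simp add: A'_def algebra_simps sum_subtractf)
      also have "(\<Sum>i\<in>UNIV. \<Sum>j\<in>UNIV. A k i * A k j / A k k * (\<xi> i * \<xi> j)) = (b \<xi>)\<^sup>2 / A k k"
        unfolding sq by (simp add: b_def power2_eq_square sum_product mult_ac)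
      finally have "(\<Sum>i\<in>UNIV. \<Sum>j\<in>UNIV. A' i j * \<xi> i * \<xi> j) =
         (\<Sum>i\<in>UNIV. \<Sum>j\<in>UNIV. A i j * \<xi> i * \<xi> j) - (b \<xi>)\<^sup>2 / A k k" .
      moreover have "2 * (- b \<xi> / A k k) * b \<xi> + (- b \<xi> / A k k)\<^sup>2 * A k k = - ((b \<xi>)\<^sup>2 / A k k)"
        using pos by (simp add: field_simps power2_eq_square)
      ultimately show ?thesis using shift[of \<xi> "- b \<xi> / A k k"] by linarith
    qed
    moreover have "A' i j = 0" if "i \<notin> S" for i j
      using that supp[of i j] supp[of i k] sym[of i k] pos by (cases "i = k") (auto simp: A'_def)
    moreover have "A' i j = A' j i" for i j using sym[of i j] by (simp add: A'_def)
    ultimately have "(\<Sum>i\<in>UNIV. \<Sum>j\<in>UNIV. A' i j * H i j) \<le> 0" by (intro insert.IH)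
    moreover have "(\<Sum>i\<in>UNIV. \<Sum>j\<in>UNIV. A' i j * H i j) = (\<Sum>i\<in>UNIV. \<Sum>j\<in>UNIV. A i j * H i j)
       - (1 / A k k) * (\<Sum>i\<in>UNIV. \<Sum>j\<in>UNIV. H i j * A k i * A k j)"
      by (simp only: sq[symmetric]) (simp add: A'_def algebra_simps sum_subtractf)
    moreover have "(1 / A k k) * (\<Sum>i\<in>UNIV. \<Sum>j\<in>UNIV. H i j * A k i * A k j) \<le> 0"
      using H[of "A k"] pos by (intro mult_nonneg_nonpos) auto
    ultimately show ?thesis by linarith
  qed
qed

text \<open>
  Neither the form of \<open>A\<close> nor, by the symmetry of \<open>H\<close>, the pairing with \<open>H\<close> sees the antisymmetric
  part of \<open>A\<close>. Without the symmetry of \<open>H\<close> the claim fails.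
\<close>

lemma sum_product_nonpos:
  fixes A H :: "'n::finite \<Rightarrow> 'n \<Rightarrow> real"
  assumes A: "\<And>\<xi>. 0 \<le> (\<Sum>i\<in>UNIV. \<Sum>j\<in>UNIV. A i j * \<xi> i * \<xi> j)"
    and Hsym: "\<And>i j. H i j = H j i"
    and H: "\<And>\<xi>. (\<Sum>i\<in>UNIV. \<Sum>j\<in>UNIV. H i j * \<xi> i * \<xi> j) \<le> 0"
  shows "(\<Sum>i\<in>UNIV. \<Sum>j\<in>UNIV. A i j * H i j) \<le> 0"
proof -
  define B where "B i j = (A i j + A j i) / 2" for i j
  have swap: "(\<Sum>i\<in>UNIV. \<Sum>j\<in>UNIV. A j i * F i j) = (\<Sum>i\<in>UNIV. \<Sum>j\<in>UNIV. A i j * F i j)"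
    if "\<And>i j. F i j = F j i" for F :: "'n \<Rightarrow> 'n \<Rightarrow> real"
    by (subst sum.swap) (simp add: that[symmetric])
  have B: "(\<Sum>i\<in>UNIV. \<Sum>j\<in>UNIV. B i j * F i j) = (\<Sum>i\<in>UNIV. \<Sum>j\<in>UNIV. A i j * F i j)"
    if F: "\<And>i j. F i j = F j i" for F :: "'n \<Rightarrow> 'n \<Rightarrow> real"
  proof -
    have "(\<Sum>i\<in>UNIV. \<Sum>j\<in>UNIV. B i j * F i j) =
       ((\<Sum>i\<in>UNIV. \<Sum>j\<in>UNIV. A i j * F i j) + (\<Sum>i\<in>UNIV. \<Sum>j\<in>UNIV. A j i * F i j)) / 2"
      by (simp add: B_def add_divide_distrib distrib_right sum.distrib sum_divide_distrib)
    then show ?thesis using swap[of F, OF F] by simp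
  qed
  have "(\<Sum>i\<in>UNIV. \<Sum>j\<in>UNIV. B i j * H i j) \<le> 0"
  proof (rule sum_product_nonpos_symmetric[of H UNIV B])
    show "0 \<le> (\<Sum>i\<in>UNIV. \<Sum>j\<in>UNIV. B i j * \<xi> i * \<xi> j)" for \<xi>
      using A[of \<xi>] B[of "\<lambda>i j. \<xi> i * \<xi> j"] by (simp add: mult_ac)
  qed (use H in \<open>auto simp: B_def\<close>)
  then show ?thesis using B[of H, OF Hsym] by simp
qed

section \<open>Partial derivatives and interior maxima\<close>

lemma has_partial_shift:
  fixes g :: "real^'n::finite \<Rightarrow> real"
  assumes "has_partial i g (z + s *\<^sub>R axis i 1)"
  shows "((\<lambda>h. g (z + h *\<^sub>R axis i 1)) has_real_derivative partial i g (z + s *\<^sub>R axis i 1)) (at s)"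
proof -
  have "((\<lambda>h. g ((z + s *\<^sub>R axis i 1) + h *\<^sub>R axis i 1)) has_real_derivative partial i g (z + s *\<^sub>R axis i 1)) (at 0)"
    using assms unfolding has_partial_def partial_def
    by (simp add: DERIV_deriv_iff_real_differentiable)
  then have "((\<lambda>h. g ((z + s *\<^sub>R axis i 1) + (h - s) *\<^sub>R axis i 1)) has_real_derivative partial i g (z + s *\<^sub>R axis i 1)) (at s)"
    using DERIV_shift[of "\<lambda>h. g ((z + s *\<^sub>R axis i 1) + (h - s) *\<^sub>R axis i 1)" _ 0 s] by simp
  then show ?thesis by (simp add: algebra_simps)
qed

lemma has_partial_iff:
  fixes g :: "real^'n::finite \<Rightarrow> real"
  shows "has_partial i g z \<longleftrightarrow>
    ((\<lambda>h. g (z + h *\<^sub>R axis i 1)) has_real_derivative partial i g z) (at 0)"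
  unfolding has_partial_def partial_def by (simp add: DERIV_deriv_iff_real_differentiable)

lemma has_partialI:
  fixes g :: "real^'n::finite \<Rightarrow> real"
  assumes "((\<lambda>h. g (z + h *\<^sub>R axis i 1)) has_real_derivative d) (at 0)"
  shows "has_partial i g z" "partial i g z = d"
  using assms unfolding has_partial_def partial_def
  by (auto simp: DERIV_imp_deriv real_differentiable_def)

lemma partial_cong_open:
  fixes g h :: "real^'n::finite \<Rightarrow> real"
  assumes "open S" "z \<in> S" "\<And>w. w \<in> S \<Longrightarrow> g w = h w"
  shows "has_partial i g z \<longleftrightarrow> has_partial i h z" "partial i g z = partial i h z"
proof -
  have "\<forall>\<^sub>F s in at (0::real). z + s *\<^sub>R axis i 1 \<in> S"
  proof (rule topological_tendstoD)
    show "((\<lambda>s. z + s *\<^sub>R axis i 1) \<longlongrightarrow> z) (at 0)"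
      by (rule tendsto_eq_intros refl | simp)+
  qed (use assms in auto)
  then have "\<forall>\<^sub>F s in nhds (0::real). z + s *\<^sub>R axis i 1 \<in> S"
    using assms(2) by (simp add: eventually_nhds_conv_at)
  then have ev: "\<forall>\<^sub>F s in nhds (0::real). g (z + s *\<^sub>R axis i 1) = h (z + s *\<^sub>R axis i 1)"
    by eventually_elim (use assms(3) in auto)
  have D: "((\<lambda>s. g (z + s *\<^sub>R axis i 1)) has_real_derivative d) (at 0) \<longleftrightarrow>
      ((\<lambda>s. h (z + s *\<^sub>R axis i 1)) has_real_derivative d) (at 0)" for d
    by (rule DERIV_cong_ev[OF refl ev refl])
  show "has_partial i g z \<longleftrightarrow> has_partial i h z"
    unfolding has_partial_def real_differentiable_def D ..
  show "partial i g z = partial i h z"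
    unfolding partial_def deriv_def D ..
qed

lemma partial_diff:
  fixes g h :: "real^'n::finite \<Rightarrow> real"
  assumes "has_partial i g z" "has_partial i h z"
  shows "has_partial i (\<lambda>w. g w - h w) z" "partial i (\<lambda>w. g w - h w) z = partial i g z - partial i h z"
  using has_partialI[OF DERIV_diff[OF assms[unfolded has_partial_iff]]] by auto

lemma partial_mvt:
  fixes g :: "real^'n::finite \<Rightarrow> real"
  assumes "\<And>s. 0 \<le> s \<Longrightarrow> s \<le> 1 \<Longrightarrow> has_partial i g (z + (s * h) *\<^sub>R axis i 1)"
  obtains \<theta> where "0 \<le> \<theta>" "\<theta> \<le> 1"
    "g (z + h *\<^sub>R axis i 1) - g z = h * partial i g (z + (\<theta> * h) *\<^sub>R axis i 1)"
proof -
  have D: "((\<lambda>s. g (z + (s * h) *\<^sub>R axis i 1)) has_real_derivative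
      partial i g (z + (s * h) *\<^sub>R axis i 1) * h) (at s)" if "0 \<le> s" "s \<le> 1" for s
  proof -
    have "((\<lambda>s. s * h) has_real_derivative h) (at s)"
      by (auto intro!: derivative_eq_intros)
    from DERIV_chain2[OF has_partial_shift[OF assms[OF that]] this] show ?thesis .
  qed
  from MVT2[of 0 1, OF zero_less_one D] obtain \<theta> where "0 < \<theta>" "\<theta> < 1"
    "g (z + (1 * h) *\<^sub>R axis i 1) - g (z + (0 * h) *\<^sub>R axis i 1) =
       (1 - 0) * (partial i g (z + (\<theta> * h) *\<^sub>R axis i 1) * h)" by blast
  then show ?thesis by (intro that[of \<theta>]) (auto simp: mult_ac)
qed

text \<open>
  The spatial half of \<open>C12\<close>, for a single profile; differentiability is only asked along the axes.
\<close>

definition C2_on :: "(real^'n) set \<Rightarrow> 'n::finite profile \<Rightarrow> bool" where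
  "C2_on S g \<longleftrightarrow>
     (\<forall>i. (\<forall>z\<in>S. has_partial i g z) \<and> continuous_on S (partial i g)) \<and>
     (\<forall>i j. (\<forall>z\<in>S. has_partial i (partial j g) z) \<and> continuous_on S (partial i (partial j g)))"

lemma norm_two_axes_le:
  assumes "\<bar>s\<bar> \<le> h" "\<bar>t\<bar> \<le> h"
  shows "norm (s *\<^sub>R axis i 1 + t *\<^sub>R axis j 1 :: real^'n::finite) \<le> 2 * h"
proof -
  have "norm (s *\<^sub>R axis i 1 + t *\<^sub>R axis j 1 :: real^'n) \<le> \<bar>s\<bar> + \<bar>t\<bar>"
    by (rule norm_triangle_le) (simp add: norm_axis_1)
  then show ?thesis using assms by linarith
qed

text \<open>
  The mean value theorem along one axis, applied to an increment along the other, turns the second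
  difference into a mixed derivative. The left-hand side is symmetric in \<open>i\<close> and \<open>j\<close> while the
  right-hand side is not, which is how the order of differentiation gets exchanged.
\<close>

lemma second_difference:
  fixes g :: "real^'n::finite \<Rightarrow> real"
  assumes C2: "C2_on S g" and h: "0 < h" and sub: "cball z (2 * h) \<subseteq> S"
  obtains w where "w \<in> cball z (2 * h)"
    "g (z + h *\<^sub>R axis i 1 + h *\<^sub>R axis j 1) - g (z + h *\<^sub>R axis i 1) - g (z + h *\<^sub>R axis j 1) + g z
      = h * h * partial j (partial i g) w"
proof -
  have mem: "z + s *\<^sub>R axis i 1 + t *\<^sub>R axis j 1 \<in> cball z (2 * h)" if "\<bar>s\<bar> \<le> h" "\<bar>t\<bar> \<le> h" for s t
    using norm_two_axes_le[OF that, of i j] by (simp add: dist_norm algebra_simps norm_minus_commute)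
  have mem0: "z + s *\<^sub>R axis i 1 \<in> cball z (2 * h)" if "\<bar>s\<bar> \<le> h" for s
    using mem[of s 0] that h by simp
  have le: "\<bar>s * h\<bar> \<le> h" if "0 \<le> s" "s \<le> 1" for s
    using that h by (simp add: abs_mult mult_left_le_one_le)
  define q where "q w = g (w + h *\<^sub>R axis j 1) - g w" for w
  have P: "has_partial i q (z + s *\<^sub>R axis i 1)"
     "partial i q (z + s *\<^sub>R axis i 1) =
        partial i g (z + s *\<^sub>R axis i 1 + h *\<^sub>R axis j 1) - partial i g (z + s *\<^sub>R axis i 1)"
    if s: "\<bar>s\<bar> \<le> h" for s
  proof -
    have 1: "has_partial i g (z + s *\<^sub>R axis i 1 + h *\<^sub>R axis j 1)" "has_partial i g (z + s *\<^sub>R axis i 1)"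
      using C2 mem[OF s, of h] mem0[OF s] sub h by (auto simp: C2_on_def)
    have "((\<lambda>t. g ((z + s *\<^sub>R axis i 1 + h *\<^sub>R axis j 1) + t *\<^sub>R axis i 1) - g (z + s *\<^sub>R axis i 1 + t *\<^sub>R axis i 1))
       has_real_derivative partial i g (z + s *\<^sub>R axis i 1 + h *\<^sub>R axis j 1) - partial i g (z + s *\<^sub>R axis i 1)) (at 0)"
      using 1 unfolding has_partial_iff by (rule DERIV_diff)
    then have "((\<lambda>t. q (z + s *\<^sub>R axis i 1 + t *\<^sub>R axis i 1))
       has_real_derivative partial i g (z + s *\<^sub>R axis i 1 + h *\<^sub>R axis j 1) - partial i g (z + s *\<^sub>R axis i 1)) (at 0)"
      unfolding q_def by (simp add: add_ac)
    from has_partialI[OF this] show "has_partial i q (z + s *\<^sub>R axis i 1)"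
     "partial i q (z + s *\<^sub>R axis i 1) =
        partial i g (z + s *\<^sub>R axis i 1 + h *\<^sub>R axis j 1) - partial i g (z + s *\<^sub>R axis i 1)" .
  qed
  obtain \<theta> where \<theta>: "0 \<le> \<theta>" "\<theta> \<le> 1"
    "q (z + h *\<^sub>R axis i 1) - q z = h * partial i q (z + (\<theta> * h) *\<^sub>R axis i 1)"
    by (rule partial_mvt[of i q z h]) (use P(1) le in blast)+
  define y where "y = z + (\<theta> * h) *\<^sub>R axis i 1"
  have memy: "y + t *\<^sub>R axis j 1 \<in> cball z (2 * h)" if "\<bar>t\<bar> \<le> h" for t
    using mem[OF le[OF \<theta>(1,2)] that] by (simp add: y_def)
  obtain \<eta> where \<eta>: "0 \<le> \<eta>" "\<eta> \<le> 1"
    "partial i g (y + h *\<^sub>R axis j 1) - partial i g y = h * partial j (partial i g) (y + (\<eta> * h) *\<^sub>R axis j 1)"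
  proof (rule partial_mvt[of j "partial i g" y h])
    show "has_partial j (partial i g) (y + (s * h) *\<^sub>R axis j 1)" if "0 \<le> s" "s \<le> 1" for s
      using C2 memy[OF le[OF that]] sub by (auto simp: C2_on_def)
  qed
  show ?thesis
  proof (rule that)
    show "y + (\<eta> * h) *\<^sub>R axis j 1 \<in> cball z (2 * h)" by (rule memy[OF le[OF \<eta>(1,2)]])
    show "g (z + h *\<^sub>R axis i 1 + h *\<^sub>R axis j 1) - g (z + h *\<^sub>R axis i 1) - g (z + h *\<^sub>R axis j 1) + g z
      = h * h * partial j (partial i g) (y + (\<eta> * h) *\<^sub>R axis j 1)"
      using \<theta>(3) \<eta>(3) P(2)[OF le[OF \<theta>(1,2)]] by (simp add: q_def y_def)
  qed
qed

lemma partial_commute: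
  fixes g :: "real^'n::finite \<Rightarrow> real"
  assumes C2: "C2_on S g" and S: "open S" "z \<in> S"
  shows "partial i (partial j g) z = partial j (partial i g) z"
proof (rule ccontr)
  let ?A = "partial i (partial j g)" and ?B = "partial j (partial i g)"
  assume "?A z \<noteq> ?B z"
  define e where "e = \<bar>?A z - ?B z\<bar> / 2"
  have e: "e > 0" using \<open>?A z \<noteq> ?B z\<close> by (simp add: e_def)
  have near: "\<exists>d>0. \<forall>w. dist w z < d \<longrightarrow> dist (q w) (q z) < e" if "continuous_on S q" for q :: "real^'n \<Rightarrow> real"
    using that S e by (simp add: continuous_on_eq_continuous_at continuous_at_eps_delta)
  obtain d1 where d1: "d1 > 0" "\<And>w. dist w z < d1 \<Longrightarrow> dist (?A w) (?A z) < e"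
    using near[of ?A] C2 by (auto simp: C2_on_def)
  obtain d2 where d2: "d2 > 0" "\<And>w. dist w z < d2 \<Longrightarrow> dist (?B w) (?B z) < e"
    using near[of ?B] C2 by (auto simp: C2_on_def)
  obtain r where r: "r > 0" "cball z r \<subseteq> S" using S open_contains_cball by blast
  define h where "h = min r (min (d1 / 2) (d2 / 2)) / 2"
  have h: "h > 0" "2 * h \<le> r" "2 * h < d1" "2 * h < d2" using r d1 d2 by (auto simp: h_def)
  have sub: "cball z (2 * h) \<subseteq> S" using r h by force
  obtain w1 where w1: "w1 \<in> cball z (2 * h)"
    "g (z + h *\<^sub>R axis i 1 + h *\<^sub>R axis j 1) - g (z + h *\<^sub>R axis i 1) - g (z + h *\<^sub>R axis j 1) + g z = h * h * ?B w1"
    by (rule second_difference[OF C2 h(1) sub])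
  obtain w2 where w2: "w2 \<in> cball z (2 * h)"
    "g (z + h *\<^sub>R axis j 1 + h *\<^sub>R axis i 1) - g (z + h *\<^sub>R axis j 1) - g (z + h *\<^sub>R axis i 1) + g z = h * h * ?A w2"
    by (rule second_difference[OF C2 h(1) sub])
  have "g (z + h *\<^sub>R axis j 1 + h *\<^sub>R axis i 1) = g (z + h *\<^sub>R axis i 1 + h *\<^sub>R axis j 1)"
    by (simp add: add_ac)
  then have "h * h * ?A w2 = h * h * ?B w1" using w1(2) w2(2) by linarith
  then have "?A w2 = ?B w1" using h(1) by simp
  moreover have "dist (?A w2) (?A z) < e" using w2(1) h by (intro d1(2)) (simp add: dist_commute)
  moreover have "dist (?B w1) (?B z) < e" using w1(1) h by (intro d2(2)) (simp add: dist_commute)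
  ultimately show False by (simp add: e_def dist_real_def abs_if split: if_splits)
qed

text \<open>
  The increment along \<open>\<xi>\<close> is split into increments along the axes, one for each coordinate; continuity
  of the partial derivatives makes each difference quotient converge although its base point moves.
\<close>

lemma directional_derivative:
  fixes g :: "real^'n::finite \<Rightarrow> real"
  assumes S: "open S" "z \<in> S" and P: "\<And>i w. w \<in> S \<Longrightarrow> has_partial i g w"
    and cont: "\<And>i. continuous_on S (partial i g)"
  shows "((\<lambda>s. g (z + s *\<^sub>R \<xi>)) has_real_derivative (\<Sum>i\<in>UNIV. \<xi> $ i * partial i g z)) (at 0)"
proof -
  have "((\<lambda>s. g (z + s *\<^sub>R (\<Sum>i\<in>I. \<xi> $ i *\<^sub>R axis i 1))) has_real_derivative
      (\<Sum>i\<in>I. \<xi> $ i * partial i g z)) (at 0)" if "finite I" for I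
    using that
  proof (induction I rule: finite_induct)
    case empty
    then show ?case by simp
  next
    case (insert i I)
    define w where "w = (\<Sum>i\<in>I. \<xi> $ i *\<^sub>R axis i (1::real))"
    define e where "e = axis i (1::real)"
    define c where "c = \<xi> $ i"
    obtain r where r: "r > 0" "ball z r \<subseteq> S" using S open_contains_ball by blast
    have near: "\<exists>p. dist p z \<le> \<bar>s\<bar> * (norm w + \<bar>c\<bar>) \<and>
        g (z + s *\<^sub>R w + (s * c) *\<^sub>R e) - g (z + s *\<^sub>R w) = s * (c * partial i g p)"
      if s: "\<bar>s\<bar> * (norm w + \<bar>c\<bar>) < r" for s
    proof -
      have b: "dist (z + s *\<^sub>R w + (\<theta> * (s * c)) *\<^sub>R e) z \<le> \<bar>s\<bar> * (norm w + \<bar>c\<bar>)"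
        if \<theta>: "0 \<le> \<theta>" "\<theta> \<le> 1" for \<theta>
      proof -
        have "norm (s *\<^sub>R w + (\<theta> * (s * c)) *\<^sub>R e) \<le> \<bar>s\<bar> * norm w + \<theta> * (\<bar>s\<bar> * \<bar>c\<bar>)"
          by (rule norm_triangle_le) (use \<theta> in \<open>simp add: e_def norm_axis_1 abs_mult\<close>)
        also have "\<dots> \<le> \<bar>s\<bar> * norm w + \<bar>s\<bar> * \<bar>c\<bar>"
          using \<theta> by (simp add: mult_left_le_one_le)
        finally show ?thesis by (simp add: dist_norm algebra_simps)
      qed
      obtain \<theta> where \<theta>: "0 \<le> \<theta>" "\<theta> \<le> 1"
        "g (z + s *\<^sub>R w + (s * c) *\<^sub>R e) - g (z + s *\<^sub>R w)
          = (s * c) * partial i g (z + s *\<^sub>R w + (\<theta> * (s * c)) *\<^sub>R e)"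
        unfolding e_def
      proof (rule partial_mvt[of i g "z + s *\<^sub>R w" "s * c"])
        fix \<theta> :: real assume "0 \<le> \<theta>" "\<theta> \<le> 1"
        from b[OF this] s r(2) show "has_partial i g (z + s *\<^sub>R w + (\<theta> * (s * c)) *\<^sub>R axis i 1)"
          by (intro P) (auto simp: e_def dist_commute)
      qed
      then show ?thesis using b[OF \<theta>(1,2)] by (auto simp: mult_ac)
    qed
    then obtain p where p: "\<And>s. \<bar>s\<bar> * (norm w + \<bar>c\<bar>) < r \<Longrightarrow> dist (p s) z \<le> \<bar>s\<bar> * (norm w + \<bar>c\<bar>) \<and>
        g (z + s *\<^sub>R w + (s * c) *\<^sub>R e) - g (z + s *\<^sub>R w) = s * (c * partial i g (p s))"
      by metis
    have small: "((\<lambda>s. \<bar>s\<bar> * (norm w + \<bar>c\<bar>)) \<longlongrightarrow> 0) (at (0::real))"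
      by (rule tendsto_eq_intros refl | simp)+
    have ev: "\<forall>\<^sub>F s in at (0::real). \<bar>s\<bar> * (norm w + \<bar>c\<bar>) < r"
      using order_tendstoD(2)[OF small r(1)] .
    have "(p \<longlongrightarrow> z) (at 0)"
    proof (rule iffD2[OF tendsto_dist_iff], rule tendsto_sandwich[OF _ _ tendsto_const small])
      show "\<forall>\<^sub>F s in at 0. dist (p s) z \<le> \<bar>s\<bar> * (norm w + \<bar>c\<bar>)"
        using ev by eventually_elim (use p in blast)
    qed simp
    moreover have "isCont (partial i g) z" using cont[of i] S by (simp add: continuous_on_eq_continuous_at)
    ultimately have "((\<lambda>s. c * partial i g (p s)) \<longlongrightarrow> c * partial i g z) (at 0)"
      by (intro tendsto_mult tendsto_const) (rule isCont_tendsto_compose)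
    moreover have "\<forall>\<^sub>F s in at (0::real). c * partial i g (p s) =
        ((g (z + s *\<^sub>R w + (s * c) *\<^sub>R e) - g (z + s *\<^sub>R w)) - 0) / (s - 0)"
      using ev eventually_neq_at_within[of "0::real"]
      by eventually_elim (use p in simp)
    ultimately have "((\<lambda>s. g (z + s *\<^sub>R w + (s * c) *\<^sub>R e) - g (z + s *\<^sub>R w)) has_real_derivative c * partial i g z) (at 0)"
      unfolding has_field_derivative_iff by (auto elim: Lim_transform_eventually)
    from DERIV_add[OF this insert.IH[folded w_def]]
    show ?case using insert.hyps by (simp add: w_def e_def c_def algebra_simps)
  qed
  from this[of UNIV] have "((\<lambda>s. g (z + s *\<^sub>R (\<Sum>i\<in>UNIV. \<xi> $ i *\<^sub>R axis i 1))) has_real_derivative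
      (\<Sum>i\<in>UNIV. \<xi> $ i * partial i g z)) (at 0)" by simp
  moreover have "(\<Sum>i\<in>UNIV. \<xi> $ i *\<^sub>R axis i (1::real)) = \<xi>"
    using basis_expansion[of \<xi>] by (simp add: scalar_mult_eq_scaleR)
  ultimately show ?thesis by simp
qed

lemma second_derivative_nonpos_at_max:
  fixes h h' :: "real \<Rightarrow> real"
  assumes d: "d > 0" and D: "\<And>s. \<bar>s\<bar> < d \<Longrightarrow> (h has_real_derivative h' s) (at s)"
    and D2: "(h' has_real_derivative D) (at 0)"
    and max: "\<And>s. \<bar>s\<bar> < d \<Longrightarrow> h s \<le> h 0"
  shows "D \<le> 0"
proof (rule ccontr)
  assume "\<not> D \<le> 0"
  have "h' 0 = 0" using DERIV_local_max[OF D[of 0] d] max d by auto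
  obtain d' where d': "d' > 0" "\<And>s. 0 < s \<Longrightarrow> s < d' \<Longrightarrow> h' 0 < h' s"
    using DERIV_pos_inc_right[OF D2] \<open>\<not> D \<le> 0\<close> by auto
  define s where "s = min d d' / 2"
  have s: "0 < s" "s < d" "s < d'" using d d' by (auto simp: s_def)
  obtain r where r: "0 < r" "r < s" "h s - h 0 = (s - 0) * h' r"
    using MVT2[of 0 s h h'] s D by auto
  have "h' r > 0" using d'(2)[of r] r s \<open>h' 0 = 0\<close> by auto
  then have "s * h' r > 0" using s by simp
  then show False using r s max[of s] by simp
qed

text \<open>
  Along every line through the maximum the second derivative is nonpositive, so the Hessian is negative
  semidefinite; its symmetry then allows pairing it with the positive semidefinite coefficient matrix.
\<close>

lemma max_principle_pointwise:
  fixes g :: "real^'n::finite \<Rightarrow> real"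
  assumes S: "open S" "z \<in> S" and C2: "C2_on S g"
    and max: "\<And>w. w \<in> S \<Longrightarrow> g w \<le> g z"
    and A: "\<And>\<xi> :: real^'n. 0 \<le> (\<Sum>i\<in>UNIV. \<Sum>j\<in>UNIV. a z $ i $ j * \<xi> $ i * \<xi> $ j)"
  shows "second_order a g z \<le> 0" and "partial i g z = 0"
proof -
  have line: "\<exists>d>0. \<forall>s. \<bar>s\<bar> < d \<longrightarrow> z + s *\<^sub>R \<xi> \<in> S" for \<xi> :: "real^'n"
  proof -
    have "((\<lambda>s. z + s *\<^sub>R \<xi>) \<longlongrightarrow> z) (at (0::real))"
      by (rule tendsto_eq_intros refl | simp)+
    then have "\<forall>\<^sub>F s in at (0::real). z + s *\<^sub>R \<xi> \<in> S"
      using S by (rule topological_tendstoD)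
    then have "\<forall>\<^sub>F s in nhds (0::real). z + s *\<^sub>R \<xi> \<in> S"
      using S(2) by (simp add: eventually_nhds_conv_at)
    then show ?thesis by (auto simp: eventually_nhds_metric dist_real_def)
  qed
  show "partial i g z = 0"
  proof -
    obtain d where d: "d > 0" "\<And>s. \<bar>s\<bar> < d \<Longrightarrow> z + s *\<^sub>R axis i 1 \<in> S" using line by blast
    have "has_partial i g z" using C2 S by (auto simp: C2_on_def)
    from DERIV_local_max[OF this[unfolded has_partial_iff] d(1)] show ?thesis
      using d(2) max by auto
  qed
  have nsd: "(\<Sum>i\<in>UNIV. \<Sum>j\<in>UNIV. partial i (partial j g) z * \<xi> $ i * \<xi> $ j) \<le> 0" for \<xi> :: "real^'n"
  proof -
    obtain d where d: "d > 0" "\<And>s. \<bar>s\<bar> < d \<Longrightarrow> z + s *\<^sub>R \<xi> \<in> S" using line by blast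
    define h' where "h' s = (\<Sum>j\<in>UNIV. \<xi> $ j * partial j g (z + s *\<^sub>R \<xi>))" for s
    have "((\<lambda>s. g (z + s *\<^sub>R \<xi>)) has_real_derivative h' s) (at s)" if "\<bar>s\<bar> < d" for s
    proof -
      have "((\<lambda>t. g ((z + s *\<^sub>R \<xi>) + t *\<^sub>R \<xi>)) has_real_derivative h' s) (at 0)"
        unfolding h'_def
        by (rule directional_derivative[OF S(1) d(2)[OF that]]) (use C2 in \<open>auto simp: C2_on_def\<close>)
      then have "((\<lambda>t. g ((z + s *\<^sub>R \<xi>) + (t - s) *\<^sub>R \<xi>)) has_real_derivative h' s) (at s)"
        using DERIV_shift[of "\<lambda>t. g ((z + s *\<^sub>R \<xi>) + (t - s) *\<^sub>R \<xi>)" _ 0 s] by simp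
      then show ?thesis by (simp add: algebra_simps)
    qed
    moreover have "(h' has_real_derivative
        (\<Sum>j\<in>UNIV. \<xi> $ j * (\<Sum>i\<in>UNIV. \<xi> $ i * partial i (partial j g) z))) (at 0)"
      unfolding h'_def
      by (intro DERIV_sum DERIV_cmult directional_derivative[OF S]) (use C2 in \<open>auto simp: C2_on_def\<close>)
    ultimately have "(\<Sum>j\<in>UNIV. \<xi> $ j * (\<Sum>i\<in>UNIV. \<xi> $ i * partial i (partial j g) z)) \<le> 0"
      by (rule second_derivative_nonpos_at_max[OF d(1)]) (use d(2) max in auto)
    then show ?thesis
      by (subst sum.swap) (simp add: sum_distrib_left mult_ac)
  qed
  show "second_order a g z \<le> 0"
    unfolding second_order_def
  proof (rule sum_product_nonpos)
    show "0 \<le> (\<Sum>i\<in>UNIV. \<Sum>j\<in>UNIV. a z $ i $ j * \<xi> i * \<xi> j)" for \<xi>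
      using A[of "\<chi> i. \<xi> i"] by simp
    show "(\<Sum>i\<in>UNIV. \<Sum>j\<in>UNIV. partial i (partial j g) z * \<xi> i * \<xi> j) \<le> 0" for \<xi>
      using nsd[of "\<chi> i. \<xi> i"] by simp
    show "partial i (partial j g) z = partial j (partial i g) z" for i j
      by (rule partial_commute[OF C2 S])
  qed
qed

lemma C2_on_cong:
  assumes S: "open S" and eq: "\<And>z. z \<in> S \<Longrightarrow> g z = h z" and C2: "C2_on S h"
  shows "C2_on S g"
    and "z \<in> S \<Longrightarrow> partial i g z = partial i h z"
    and "z \<in> S \<Longrightarrow> partial i (partial j g) z = partial i (partial j h) z"
proof -
  have 1: "has_partial i g w \<longleftrightarrow> has_partial i h w" "partial i g w = partial i h w" if "w \<in> S" for i w
    using partial_cong_open[of S w g h] S eq that by auto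
  have 2: "has_partial i (partial j g) w \<longleftrightarrow> has_partial i (partial j h) w"
    "partial i (partial j g) w = partial i (partial j h) w" if "w \<in> S" for i j w
    using partial_cong_open[of S w "partial j g" "partial j h"] S 1 that by auto
  show "C2_on S g"
    using C2 1 2 by (simp add: C2_on_def cong: continuous_on_cong)
  show "z \<in> S \<Longrightarrow> partial i g z = partial i h z"
    and "z \<in> S \<Longrightarrow> partial i (partial j g) z = partial i (partial j h) z"
    using 1 2 by auto
qed

lemma C2_on_diff:
  assumes S: "open S" and g: "C2_on S g" and h: "C2_on S h"
  shows "C2_on S (\<lambda>w. g w - h w)"
    and "z \<in> S \<Longrightarrow> partial i (\<lambda>w. g w - h w) z = partial i g z - partial i h z"
    and "z \<in> S \<Longrightarrow> partial i (partial j (\<lambda>w. g w - h w)) z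
           = partial i (partial j g) z - partial i (partial j h) z"
proof -
  let ?d = "\<lambda>w. g w - h w"
  have 1: "has_partial i ?d w" "partial i ?d w = partial i g w - partial i h w" if "w \<in> S" for i w
    using partial_diff[of i g w h] g h that by (auto simp: C2_on_def)
  have 2: "has_partial i (partial j ?d) w"
    "partial i (partial j ?d) w = partial i (partial j g) w - partial i (partial j h) w"
    if "w \<in> S" for i j w
  proof -
    have "has_partial i (\<lambda>w. partial j g w - partial j h w) w"
      "partial i (\<lambda>w. partial j g w - partial j h w) w = partial i (partial j g) w - partial i (partial j h) w"
      using partial_diff[of i "partial j g" w "partial j h"] g h that by (auto simp: C2_on_def)
    then show "has_partial i (partial j ?d) w"
      "partial i (partial j ?d) w = partial i (partial j g) w - partial i (partial j h) w"
      using partial_cong_open[of S w "partial j ?d" "\<lambda>w. partial j g w - partial j h w"] S 1(2) that by auto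
  qed
  show "C2_on S ?d"
    unfolding C2_on_def
  proof (intro conjI allI ballI)
    show "continuous_on S (partial i ?d)" for i
    proof (rule continuous_on_eq)
      show "continuous_on S (\<lambda>w. partial i g w - partial i h w)"
        using g h by (auto simp: C2_on_def intro!: continuous_intros)
    qed (simp add: 1)
    show "continuous_on S (partial i (partial j ?d))" for i j
    proof (rule continuous_on_eq)
      show "continuous_on S (\<lambda>w. partial i (partial j g) w - partial i (partial j h) w)"
        using g h by (auto simp: C2_on_def intro!: continuous_intros)
    qed (simp add: 2)
  qed (simp_all add: 1 2)
  show "z \<in> S \<Longrightarrow> partial i ?d z = partial i g z - partial i h z"
    and "z \<in> S \<Longrightarrow> partial i (partial j ?d) z = partial i (partial j g) z - partial i (partial j h) z"
    using 1 2 by auto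
qed

lemma partial_const: "has_partial i (\<lambda>_. c) z" "partial i (\<lambda>_. c) = (\<lambda>_. 0)"
  using has_partialI[of "\<lambda>_. c" _ i 0] by (simp_all add: fun_eq_iff)

lemma C2_on_const: "C2_on S (\<lambda>_. c)"
  by (simp add: C2_on_def partial_const)

lemma continuous_on_slice:
  assumes "continuous_on (T \<times> S) (\<lambda>(t, z). F t z)" "t \<in> T"
  shows "continuous_on S (F t)"
proof -
  have "continuous_on S (\<lambda>z. (t, z))" by (intro continuous_intros)
  from continuous_on_compose2[OF assms(1) this] show ?thesis using assms(2) by auto
qed

lemma C12_slice:
  assumes x: "C12 G x" and t: "t > 0"
  shows "C2_on G (x t)"
  unfolding C2_on_def
proof (intro conjI allI ballI)
  have t': "t \<in> {0<..}" using t by simp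
  show "has_partial i (x t) z" "has_partial i (partial j (x t)) z" if "z \<in> G" for i j z
    using x t that by (simp_all add: C12_def)
  show "continuous_on G (partial i (x t))" for i
    by (rule continuous_on_slice[where F = "\<lambda>t. partial i (x t)", OF _ t'])
      (use x in \<open>simp add: C12_def\<close>)
  show "continuous_on G (partial i (partial j (x t)))" for i j
    by (rule continuous_on_slice[where F = "\<lambda>t. partial i (partial j (x t))", OF _ t'])
      (use x in \<open>simp add: C12_def\<close>)
qed

lemma CL_D:
  assumes x: "x \<in> CL G"
  shows "t \<ge> 0 \<Longrightarrow> x t \<in> extensional (closure G)"
    and "x \<in> extensional {0..}"
    and "continuous_on ({0..} \<times> closure G) (\<lambda>(t, z). x t z)"
    and "C12 G x"
    and "t \<ge> 0 \<Longrightarrow> continuous_on (closure G) (x t)"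
    and "t > 0 \<Longrightarrow> z \<in> G \<Longrightarrow> ((\<lambda>s. x s z) has_real_derivative deriv (\<lambda>s. x s z) t) (at t)"
    and "t > 0 \<Longrightarrow> C2_on G (x t)"
proof -
  show "t \<ge> 0 \<Longrightarrow> x t \<in> extensional (closure G)" "x \<in> extensional {0..}"
    and cont: "continuous_on ({0..} \<times> closure G) (\<lambda>(t, z). x t z)" and C12: "C12 G x"
    using x by (auto simp: CL_def PiE_def)
  show "t \<ge> 0 \<Longrightarrow> continuous_on (closure G) (x t)"
    by (rule continuous_on_slice[OF cont]) simp
  show "t > 0 \<Longrightarrow> z \<in> G \<Longrightarrow> ((\<lambda>s. x s z) has_real_derivative deriv (\<lambda>s. x s z) t) (at t)"
    using C12 by (simp add: C12_def DERIV_deriv_iff_real_differentiable)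
  show "t > 0 \<Longrightarrow> C2_on G (x t)" by (rule C12_slice[OF C12])
qed

section \<open>The comparison principle\<close>

text \<open>
  The factor \<open>exp (- k * t)\<close> absorbs the Lipschitz constant of \<open>H2\<close>: at a positive maximum of
  \<open>exp (- k * t) * (x - y)\<close> over the cylinder up to time \<open>T\<close>, the time derivative is nonnegative, which
  forces the time derivative of \<open>x - y\<close> to be at least \<open>k * (x - y)\<close>, whereas the equation and \<open>H2\<close>
  make it strictly smaller.
\<close>

lemma comparison_principle:
  fixes x y :: "'n::finite evolution"
  assumes G: "open G" "bounded G" and par: "uniformly_parabolic G a" and "H2 G f"
    and x: "x \<in> CL G" and y: "y \<in> CL G"
    and Lxy: "\<And>t z. t > 0 \<Longrightarrow> z \<in> G \<Longrightarrow> L_op a f x t z \<le> L_op a f y t z"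
    and init: "\<And>z. z \<in> G \<Longrightarrow> x 0 z \<le> y 0 z"
    and bdry: "\<And>t z. t \<ge> 0 \<Longrightarrow> z \<in> frontier G \<Longrightarrow> x t z \<le> y t z"
    and T: "T \<ge> 0" and \<zeta>: "\<zeta> \<in> closure G"
  shows "x T \<zeta> \<le> y T \<zeta>"
proof (rule ccontr)
  assume "\<not> x T \<zeta> \<le> y T \<zeta>"
  then have gt: "x T \<zeta> > y T \<zeta>" by simp
  define K where "K = {0..T} \<times> closure G"
  have K: "compact K" unfolding K_def using G by (intro compact_Times) auto
  have cx: "continuous_on K (\<lambda>(t, z). x t z)" and cy: "continuous_on K (\<lambda>(t, z). y t z)"
    using CL_D(3)[OF x] CL_D(3)[OF y]
    by (auto simp: K_def elim!: continuous_on_subset)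
  \<comment> \<open>H2 gives a Lipschitz constant only on bounded sets, which compactness provides.\<close>
  define W where "W = (\<lambda>(t, z). x t z) ` K \<union> (\<lambda>(t, z). y t z) ` K"
  have "bounded W" unfolding W_def
    by (intro bounded_Un[THEN iffD2] conjI compact_imp_bounded compact_continuous_image cx cy K)
  then obtain k where k: "\<And>w1 w2 z \<xi>. w1 \<in> W \<Longrightarrow> w2 \<in> W \<Longrightarrow> w1 > w2 \<Longrightarrow> z \<in> G \<Longrightarrow>
      f z w1 \<xi> - f z w2 \<xi> < k * (w1 - w2)"
    using \<open>H2 G f\<close> unfolding H2_def by meson
  define F where "F = (\<lambda>(t, z). exp (- k * t) * (x t z - y t z))"
  have "continuous_on K F"
    using cx cy unfolding F_def case_prod_unfold by (intro continuous_intros)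
  moreover have "(T, \<zeta>) \<in> K" using T \<zeta> by (simp add: K_def)
  ultimately obtain m where m: "m \<in> K" "\<And>q. q \<in> K \<Longrightarrow> F q \<le> F m"
    using continuous_attains_sup[OF K, of F] by blast
  obtain t0 z0 where m_eq: "m = (t0, z0)" by fastforce
  have t0: "0 \<le> t0" "t0 \<le> T" and z0: "z0 \<in> closure G" using m(1) by (auto simp: m_eq K_def)
  have "F (T, \<zeta>) > 0" using gt by (simp add: F_def)
  then have "F m > 0" using m(2)[OF \<open>(T, \<zeta>) \<in> K\<close>] by linarith
  then have gt0: "x t0 z0 > y t0 z0" by (simp add: F_def m_eq zero_less_mult_iff)
  have z0G: "z0 \<in> G"
  proof (rule ccontr)
    assume "z0 \<notin> G"
    then have "z0 \<in> frontier G" using z0 G(1) by (simp add: frontier_def interior_open)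
    then show False using bdry[OF t0(1), of z0] gt0 by simp
  qed
  have t0pos: "t0 > 0" using init[OF z0G] gt0 t0(1) by (cases "t0 = 0") auto
  define g where "g w = x t0 w - y t0 w" for w
  have C2: "C2_on G (x t0)" "C2_on G (y t0)"
    using CL_D(7)[OF x t0pos] CL_D(7)[OF y t0pos] by auto
  have max: "g w \<le> g z0" if "w \<in> G" for w
  proof -
    have "F (t0, w) \<le> F (t0, z0)"
      using m(2)[of "(t0, w)"] that t0 closure_subset[of G] by (auto simp: m_eq K_def)
    then show ?thesis by (simp add: F_def g_def)
  qed
  have psd: "0 \<le> (\<Sum>i\<in>UNIV. \<Sum>j\<in>UNIV. a z0 $ i $ j * \<xi> $ i * \<xi> $ j)" for \<xi> :: "real^'n"
  proof -
    obtain K where "K > 0" "\<And>\<xi>::real^'n. (\<Sum>i\<in>UNIV. \<Sum>j\<in>UNIV. a z0 $ i $ j * \<xi> $ i * \<xi> $ j) \<ge> K * (norm \<xi>)\<^sup>2"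
      using par z0 unfolding uniformly_parabolic_def by blast
    then show ?thesis by (meson order_trans mult_nonneg_nonneg less_imp_le zero_le_power2)
  qed
  have g_eq: "g = (\<lambda>w. x t0 w - y t0 w)" by (auto simp: g_def)
  note C2g = C2_on_diff[OF G(1) C2, folded g_eq]
  have so: "second_order a g z0 \<le> 0" and pz: "\<And>i. partial i g z0 = 0"
    using max_principle_pointwise[where a = a and g = g and S = G and z = z0, OF G(1) z0G C2g(1) max psd] by auto
  have "second_order a g z0 = second_order a (x t0) z0 - second_order a (y t0) z0"
    by (simp add: second_order_def C2g(3)[OF z0G] right_diff_distrib sum_subtractf)
  moreover have grad: "grad (x t0) z0 = grad (y t0) z0"
    using pz C2g(2)[OF z0G] by (simp add: grad_def vec_eq_iff)
  moreover have "x t0 z0 \<in> W" "y t0 z0 \<in> W"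
    unfolding W_def using m(1)[unfolded m_eq] by (auto intro: rev_image_eqI)
  then have "f z0 (x t0 z0) (grad (x t0) z0) - f z0 (y t0 z0) (grad (x t0) z0) < k * (x t0 z0 - y t0 z0)"
    by (rule k) (use gt0 z0G in auto)
  ultimately have neg: "deriv (\<lambda>s. x s z0) t0 - deriv (\<lambda>s. y s z0) t0 - k * (x t0 z0 - y t0 z0) < 0"
    using Lxy[OF t0pos z0G] so unfolding L_op_def by simp
  \<comment> \<open>The maximum may lie on the top of the cylinder, so only times before t0 are compared.\<close>
  define \<psi> where "\<psi> s = F (s, z0)" for s
  have "(\<psi> has_real_derivative exp (- k * t0) *
      (deriv (\<lambda>s. x s z0) t0 - deriv (\<lambda>s. y s z0) t0 - k * (x t0 z0 - y t0 z0))) (at t0)"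
    unfolding \<psi>_def F_def
    using CL_D(6)[OF x t0pos z0G] CL_D(6)[OF y t0pos z0G]
    by (auto intro!: derivative_eq_intros simp: algebra_simps)
  from DERIV_neg_dec_left[OF this] neg obtain d where d: "d > 0" "\<And>h. 0 < h \<Longrightarrow> h < d \<Longrightarrow> \<psi> t0 < \<psi> (t0 - h)"
    by (auto simp: mult_pos_neg)
  define h where "h = min d t0 / 2"
  have h: "0 < h" "h < d" "h < t0" using d t0pos by (auto simp: h_def)
  have "\<psi> (t0 - h) \<le> \<psi> t0"
    using m(2)[of "(t0 - h, z0)"] h t0 z0 by (simp add: \<psi>_def m_eq K_def)
  then show False using d(2)[OF h(1,2)] by simp
qed

section \<open>Uniqueness and the transition maps\<close>

lemma BI_solution_le:
  assumes G: "open G" "bounded G" "uniformly_parabolic G a" "H2 G f"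
    and x: "BI_solution G a f x0 u x" and y: "BI_solution G a f y0 v y"
    and "\<And>z. z \<in> G \<Longrightarrow> x0 z \<le> y0 z"
    and "\<And>t z. t \<ge> 0 \<Longrightarrow> z \<in> frontier G \<Longrightarrow> u t z \<le> v t z"
    and "t \<ge> 0" "z \<in> closure G"
  shows "x t z \<le> y t z"
proof (rule comparison_principle[OF G, of x y])
  have fr: "z \<in> frontier G \<Longrightarrow> x t z = u t z \<and> y t z = v t z" if "t \<ge> 0" for t z
    using x y that by (simp add: BI_solution_def)
  show "x \<in> CL G" "y \<in> CL G" using x y by (simp_all add: BI_solution_def)
  show "L_op a f x t z \<le> L_op a f y t z" if "t > 0" "z \<in> G" for t z
    using x y that by (simp add: BI_solution_def)
  show "x 0 z \<le> y 0 z" if "z \<in> G" for z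
    using x y that assms(7) by (simp add: BI_solution_def)
  show "x t z \<le> y t z" if "t \<ge> 0" "z \<in> frontier G" for t z
    using fr[OF that] assms(8)[OF that] by simp
qed (rule assms(9,10))+

lemma BI_solution_unique:
  assumes G: "open G" "bounded G" "uniformly_parabolic G a" "H2 G f"
    and x: "BI_solution G a f x0 u x" and y: "BI_solution G a f x0 u y"
  shows "x = y"
proof -
  have CL: "x \<in> CL G" "y \<in> CL G" using x y by (auto simp: BI_solution_def)
  have "x t z = y t z" if "t \<ge> 0" "z \<in> closure G" for t z
    using BI_solution_le[OF G x y] BI_solution_le[OF G y x] that by (simp add: order_antisym)
  then have "x t = y t" if "t \<ge> 0" for t
    using CL_D(1)[OF CL(1) that] CL_D(1)[OF CL(2) that] that by (auto intro: extensionalityI)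
  then show ?thesis
    using CL_D(2)[OF CL(1)] CL_D(2)[OF CL(2)] by (auto intro: extensionalityI)
qed

lemma BI_flow_eq:
  assumes G: "open G" "bounded G" "uniformly_parabolic G a" "H2 G f"
    and x: "BI_solution G a f x0 u x"
  shows "BI_flow G a f t x0 u = x t"
proof -
  have uniq: "y = x" if "BI_solution G a f x0 u y" for y
    by (rule BI_solution_unique[OF G that x])
  have "(THE y. BI_solution G a f x0 u y) = x"
    by (rule the_equality[where P = "BI_solution G a f x0 u", OF x uniq])
  then show ?thesis unfolding BI_flow_def by (rule fun_cong)
qed

section \<open>Gains of class K-infinity\<close>

lemma class_K_inf_affine:
  assumes \<gamma>: "\<gamma> \<in> class_K_inf" and "a > 0" "b \<ge> 0"
  shows "(\<lambda>s. a * \<gamma> s + b * s) \<in> class_K_inf"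
proof -
  have \<gamma>0: "\<gamma> s \<ge> 0" if "s \<ge> 0" for s using \<gamma> that by (auto simp: class_K_inf_def)
  have mono: "a * \<gamma> r + b * r < a * \<gamma> s + b * s" if "0 \<le> r" "r < s" for r s
  proof -
    have "\<gamma> r < \<gamma> s" using \<gamma> that by (auto simp: class_K_inf_def strict_mono_on_def)
    then show ?thesis using that assms by (intro add_less_le_mono mult_strict_left_mono mult_left_mono) auto
  qed
  have "\<not> bounded ((\<lambda>s. a * \<gamma> s + b * s) ` {0..})"
  proof
    assume "bounded ((\<lambda>s. a * \<gamma> s + b * s) ` {0..})"
    then obtain B where B: "\<And>s. s \<ge> 0 \<Longrightarrow> \<bar>a * \<gamma> s + b * s\<bar> \<le> B"
      by (auto simp: bounded_iff)
    have "\<bar>\<gamma> s\<bar> \<le> B / a" if "s \<ge> 0" for s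
    proof -
      have "b * s \<ge> 0" using assms that by simp
      then have "a * \<gamma> s \<le> B" using B[OF that] by linarith
      then show ?thesis using assms \<gamma>0[OF that] by (simp add: field_simps)
    qed
    then have "bounded (\<gamma> ` {0..})" by (auto simp: bounded_iff)
    then show False using \<gamma> by (simp add: class_K_inf_def)
  qed
  moreover have "(\<lambda>s. a * \<gamma> s + b * s) \<in> {0..} \<rightarrow> {0..}" using \<gamma>0 assms by auto
  moreover have "continuous_on {0..} (\<lambda>s. a * \<gamma> s + b * s)"
    using \<gamma> by (auto simp: class_K_inf_def intro!: continuous_intros)
  ultimately show ?thesis
    using \<gamma> mono by (auto simp: class_K_inf_def strict_mono_on_def)
qed

text \<open>
  Removes the margin by which boundary values must exceed the norm of the input.
\<close>

lemma class_K_inf_le_limit: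
  assumes \<gamma>: "\<gamma> \<in> class_K_inf" and B: "B \<ge> 0" and le: "\<And>e. e > 0 \<Longrightarrow> y \<le> A + \<gamma> (B + e)"
  shows "y \<le> A + \<gamma> B"
proof (rule tendsto_lowerbound)
  have "((\<lambda>e. B + e) \<longlongrightarrow> B) (at_right 0)" by (rule tendsto_eq_intros refl | simp)+
  then have "((\<lambda>e. \<gamma> (B + e)) \<longlongrightarrow> \<gamma> B) (at_right 0)"
    using \<gamma> B
    by (intro continuous_on_tendsto_compose[of "{0..}" \<gamma>])
      (auto simp: class_K_inf_def eventually_at_right_less intro: eventually_at_rightI[of 0 1])
  then show "((\<lambda>e. A + \<gamma> (B + e)) \<longlongrightarrow> A + \<gamma> B) (at_right 0)" by (intro tendsto_intros)
  show "\<forall>\<^sub>F e in at_right 0. y \<le> A + \<gamma> (B + e)"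
    using le by (intro eventually_at_rightI[of 0 1]) auto
qed simp

section \<open>Estimates for the norms of states and inputs\<close>

lemma emeasure_open_nonzero:
  fixes G :: "(real^'n::finite) set"
  assumes "open G" "G \<noteq> {}"
  shows "emeasure (lebesgue_on G) (space (lebesgue_on G)) \<noteq> 0"
proof -
  have "G \<in> sets lebesgue" using assms by auto
  then show ?thesis
    using open_not_negligible[OF assms] by (simp add: emeasure_restrict_space negligible_iff_emeasure0)
qed

lemma continuous_on_closure_measurable_bounded:
  fixes G :: "(real^'n::finite) set" and h :: "real^'n \<Rightarrow> real"
  assumes "open G" "bounded G" and h: "continuous_on (closure G) h"
  shows "h \<in> borel_measurable (lebesgue_on G)" and "\<exists>B\<ge>0. \<forall>z\<in>G. \<bar>h z\<bar> \<le> B"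
proof -
  show "h \<in> borel_measurable (lebesgue_on G)"
    using assms by (intro continuous_imp_measurable_on_sets_lebesgue)
      (auto intro: continuous_on_subset[OF h closure_subset])
  have "compact (closure G)" using assms by auto
  then have "bounded (h ` closure G)" using h by (intro compact_imp_bounded compact_continuous_image)
  then obtain B where "\<And>z. z \<in> closure G \<Longrightarrow> \<bar>h z\<bar> \<le> B" by (auto simp: bounded_iff)
  then show "\<exists>B\<ge>0. \<forall>z\<in>G. \<bar>h z\<bar> \<le> B"
    using closure_subset[of G] by (intro exI[of _ "max 0 B"]) (auto simp: le_max_iff_disj)
qed

text \<open>
  The essential supremum is finite here, since \<open>h\<close> is bounded and \<open>G\<close> has positive measure, so the
  conversion to a real number loses nothing.
\<close>

lemma Linf_norm_AE:
  fixes G :: "(real^'n::finite) set" and h :: "real^'n \<Rightarrow> real"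
  assumes G: "open G" "bounded G" "G \<noteq> {}" and h: "continuous_on (closure G) h"
  shows "AE z in lebesgue_on G. \<bar>h z\<bar> \<le> Lp_norm \<infinity> G h"
    and "AE z in lebesgue_on G. \<bar>h z\<bar> \<le> c \<Longrightarrow> Lp_norm \<infinity> G h \<le> c"
proof -
  let ?M = "lebesgue_on G" and ?E = "esssup (lebesgue_on G) (\<lambda>z. ereal \<bar>h z\<bar>)"
  note [measurable] = continuous_on_closure_measurable_bounded(1)[OF G(1,2) h]
  obtain B where B: "\<And>z. z \<in> G \<Longrightarrow> \<bar>h z\<bar> \<le> B"
    using continuous_on_closure_measurable_bounded(2)[OF G(1,2) h] by auto
  have "?E \<le> ereal B" using B by (intro esssup_I AE_I2) auto
  moreover have "0 \<le> ?E"
  proof -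
    have "esssup ?M (\<lambda>_. 0 :: ereal) \<le> ?E" by (rule esssup_mono) auto
    then show ?thesis by (simp add: esssup_const[OF emeasure_open_nonzero[OF G(1,3)]])
  qed
  ultimately have E: "?E = ereal (Lp_norm \<infinity> G h)"
    by (simp add: Lp_norm_def) (cases ?E; auto)
  show "AE z in ?M. \<bar>h z\<bar> \<le> Lp_norm \<infinity> G h"
    using esssup_AE[where M = ?M and f = "\<lambda>z. ereal \<bar>h z\<bar>"] unfolding E by simp
  assume "AE z in ?M. \<bar>h z\<bar> \<le> c"
  then have "?E \<le> ereal c" by (intro esssup_I) auto
  then show "Lp_norm \<infinity> G h \<le> c" unfolding E by simp
qed

text \<open>
  After division by \<open>a + b\<close> this is \<open>u \<le> u powr r\<close> for \<open>u \<in> {0..1}\<close>.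
\<close>

lemma powr_subadditive:
  fixes a b r :: real
  assumes a: "0 \<le> a" and b: "0 \<le> b" and r: "0 < r" "r \<le> 1"
  shows "(a + b) powr r \<le> a powr r + b powr r"
proof (cases "a + b = 0")
  case True
  then show ?thesis by simp
next
  case False
  define s where "s = a + b"
  have s: "s > 0" using a b False by (simp add: s_def)
  have le: "c / s * s powr r \<le> c powr r" if c: "0 \<le> c" "c \<le> s" for c
  proof -
    have "(c / s) powr 1 \<le> (c / s) powr r"
      using c s r by (intro powr_mono') auto
    then have "c / s \<le> (c / s) powr r" using c s by simp
    then have "c / s * s powr r \<le> (c / s) powr r * s powr r" by (rule mult_right_mono) simp
    also have "\<dots> = c powr r" using c s by (simp flip: powr_mult)
    finally show ?thesis .
  qed
  have "a / s + b / s = 1" using s by (simp add: s_def flip: add_divide_distrib)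
  then have "(a + b) powr r = (a / s + b / s) * s powr r" by (simp add: s_def)
  also have "\<dots> = a / s * s powr r + b / s * s powr r" by (rule distrib_right)
  also have "\<dots> \<le> a powr r + b powr r"
    using a b by (intro add_mono le) (simp_all add: s_def)
  finally show ?thesis .
qed

text \<open>
  A substitute for the triangle inequality. The factor 2 is harmless, because the constants in exp-ISS are
  free, and it allows the elementary estimate
  \<open>(s + t) powr q \<le> 2 powr q * (s powr q + t powr q)\<close> in place of Minkowski's inequality.
\<close>

lemma Lp_norm_le_two_sum:
  fixes G :: "(real^'n::finite) set" and g h1 h2 :: "real^'n \<Rightarrow> real"
  assumes G: "open G" "bounded G" "G \<noteq> {}" and p: "1 \<le> p"
    and g: "continuous_on (closure G) g"
    and h1: "continuous_on (closure G) h1" and h2: "continuous_on (closure G) h2"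
    and le: "\<And>z. z \<in> G \<Longrightarrow> \<bar>g z\<bar> \<le> \<bar>h1 z\<bar> + \<bar>h2 z\<bar>"
  shows "Lp_norm p G g \<le> 2 * (Lp_norm p G h1 + Lp_norm p G h2)"
proof (cases "p = \<infinity>")
  case True
  have AE: "AE z in lebesgue_on G. \<bar>g z\<bar> \<le> Lp_norm \<infinity> G h1 + Lp_norm \<infinity> G h2"
    using Linf_norm_AE(1)[OF G h1] Linf_norm_AE(1)[OF G h2] AE_space
    by eventually_elim (use le in fastforce)
  then have 1: "Lp_norm \<infinity> G g \<le> Lp_norm \<infinity> G h1 + Lp_norm \<infinity> G h2"
    by (rule Linf_norm_AE(2)[OF G g])
  have "0 \<le> Lp_norm \<infinity> G h1 + Lp_norm \<infinity> G h2"
  proof (rule ccontr)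
    assume "\<not> ?thesis"
    with AE have "AE z in lebesgue_on G. False" by auto
    then show False
      using emeasure_open_nonzero[OF G(1,3)] by (simp add: eventually_False ae_filter_eq_bot_iff)
  qed
  then have "Lp_norm \<infinity> G h1 + Lp_norm \<infinity> G h2 \<le> 2 * (Lp_norm \<infinity> G h1 + Lp_norm \<infinity> G h2)"
    by simp
  with 1 show ?thesis unfolding True by (rule order_trans)
next
  case False
  define q where "q = real_of_ereal p"
  have q: "q \<ge> 1" using p False by (cases p) (auto simp: q_def)
  let ?M = "lebesgue_on G"
  define I where "I h = (LINT z|?M. \<bar>h z\<bar> powr q)" for h :: "real^'n \<Rightarrow> real"
  have Lp: "Lp_norm p G h = I h powr (1 / q)" for h using False by (simp add: Lp_norm_def I_def q_def)
  have "G \<in> lmeasurable" using G by (simp add: lmeasurable_open)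
  then interpret finite_measure ?M by (rule finite_measure_lebesgue_on)
  have int: "integrable ?M (\<lambda>z. \<bar>h z\<bar> powr q)" if h: "continuous_on (closure G) h" for h
  proof -
    note [measurable] = continuous_on_closure_measurable_bounded(1)[OF G(1,2) h]
    obtain B where B: "\<And>z. z \<in> G \<Longrightarrow> \<bar>h z\<bar> \<le> B"
      using continuous_on_closure_measurable_bounded(2)[OF G(1,2) h] by auto
    show ?thesis
      using B q by (intro integrable_const_bound[of _ "B powr q"] AE_I2) (auto intro!: powr_mono2)
  qed
  have I0: "I h \<ge> 0" for h by (simp add: I_def)
  have "I g \<le> (LINT z|?M. 2 powr q * (\<bar>h1 z\<bar> powr q + \<bar>h2 z\<bar> powr q))"
    unfolding I_def
  proof (rule integral_mono)
    show "integrable ?M (\<lambda>z. 2 powr q * (\<bar>h1 z\<bar> powr q + \<bar>h2 z\<bar> powr q))"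
      using int[OF h1] int[OF h2] by auto
    show "\<bar>g z\<bar> powr q \<le> 2 powr q * (\<bar>h1 z\<bar> powr q + \<bar>h2 z\<bar> powr q)" if "z \<in> space ?M" for z
    proof -
      define m where "m = max \<bar>h1 z\<bar> \<bar>h2 z\<bar>"
      have "\<bar>g z\<bar> powr q \<le> (2 * m) powr q"
        using le[of z] that q by (intro powr_mono2) (auto simp: m_def)
      also have "\<dots> = 2 powr q * m powr q" by (simp add: powr_mult m_def)
      also have "m powr q \<le> \<bar>h1 z\<bar> powr q + \<bar>h2 z\<bar> powr q" by (auto simp: m_def max_def)
      finally show ?thesis by simp
    qed
  qed (rule int[OF g])
  also have "\<dots> = 2 powr q * (I h1 + I h2)"
    using int[OF h1] int[OF h2] by (simp add: I_def)
  finally have "I g powr (1 / q) \<le> (2 powr q * (I h1 + I h2)) powr (1 / q)"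
    using I0 q by (intro powr_mono2) auto
  also have "\<dots> = 2 * (I h1 + I h2) powr (1 / q)"
    using I0 q by (simp add: powr_mult powr_powr)
  also have "(I h1 + I h2) powr (1 / q) \<le> I h1 powr (1 / q) + I h2 powr (1 / q)"
    using I0[of h1] I0[of h2] q by (intro powr_subadditive) auto
  finally show ?thesis by (simp add: Lp)
qed

lemma Lp_norm_const:
  fixes G :: "(real^'n::finite) set"
  assumes G: "open G" "bounded G" "G \<noteq> {}" and p: "1 \<le> p"
  shows "Lp_norm p G (\<lambda>_. c) = \<bar>c\<bar> * Lp_norm p G (\<lambda>_. 1)" and "Lp_norm p G (\<lambda>_. 1) \<ge> 0"
proof -
  have "p = \<infinity> \<or> real_of_ereal p \<ge> 1" using p by (cases p) auto
  then show "Lp_norm p G (\<lambda>_. c) = \<bar>c\<bar> * Lp_norm p G (\<lambda>_. 1)"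
    by (auto simp: Lp_norm_def powr_mult powr_powr esssup_const[OF emeasure_open_nonzero[OF G(1,3)]])
  show "Lp_norm p G (\<lambda>_. 1) \<ge> 0"
    by (auto simp: Lp_norm_def esssup_const[OF emeasure_open_nonzero[OF G(1,3)]])
qed

lemma input_norm_const:
  assumes "S \<noteq> {}" "\<And>t z. t \<ge> 0 \<Longrightarrow> z \<in> S \<Longrightarrow> u t z = c"
  shows "input_norm S u = \<bar>c\<bar>"
proof -
  have "(\<lambda>(t, z). \<bar>u t z\<bar>) ` ({0..} \<times> S) = {\<bar>c\<bar>}"
    using assms by (force simp: image_iff)
  then show ?thesis by (simp add: input_norm_def)
qed

lemma input_norm_upper:
  assumes "u \<in> boundary_inputs G" "t \<ge> 0" "z \<in> frontier G"
  shows "\<bar>u t z\<bar> \<le> input_norm (frontier G) u"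
proof -
  obtain B where "\<And>t z. t \<ge> 0 \<Longrightarrow> z \<in> frontier G \<Longrightarrow> \<bar>u t z\<bar> \<le> B"
    using assms(1) unfolding boundary_inputs_def by blast
  then have "bdd_above ((\<lambda>(t, z). \<bar>u t z\<bar>) ` ({0..} \<times> frontier G))"
    by (intro bdd_aboveI[of _ B]) auto
  from cSUP_upper[OF _ this, of "(t, z)"] show ?thesis using assms by (simp add: input_norm_def)
qed

section \<open>Translation between boundary and distributed inputs\<close>

lemma translate_CL:
  fixes x :: "'n::finite evolution" and c :: real
  assumes G: "open G" and x: "x \<in> CL G"
  defines "y \<equiv> \<lambda>t\<in>{0..}. \<lambda>z\<in>closure G. x t z + c"
  shows "y \<in> CL G"
    and "t > 0 \<Longrightarrow> z \<in> G \<Longrightarrow> deriv (\<lambda>s. y s z) t = deriv (\<lambda>s. x s z) t"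
    and "t > 0 \<Longrightarrow> z \<in> G \<Longrightarrow> second_order a (y t) z = second_order a (x t) z"
    and "t > 0 \<Longrightarrow> z \<in> G \<Longrightarrow> grad (y t) z = grad (x t) z"
proof -
  have sub: "z \<in> closure G" if "z \<in> G" for z using that closure_subset by blast
  have yx: "y t z = x t z + c" if "t \<ge> 0" "z \<in> closure G" for t z using that by (simp add: y_def)
  have der: "((\<lambda>s. y s z) has_real_derivative deriv (\<lambda>s. x s z) t) (at t)" if "t > 0" "z \<in> G" for t z
  proof -
    have "((\<lambda>s. x s z + c) has_real_derivative deriv (\<lambda>s. x s z) t) (at t)"
      using DERIV_add[OF CL_D(6)[OF x that] DERIV_const[of c]] by simp
    moreover have ev: "\<forall>\<^sub>F s in nhds t. x s z + c = y s z"
    proof (rule eventually_mono)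
      show "\<forall>\<^sub>F s in nhds t. s \<in> {0<..}" using that(1) by (intro eventually_nhds_in_open) auto
    qed (simp add: yx sub[OF that(2)])
    ultimately show ?thesis using DERIV_cong_ev[OF refl ev refl] by simp
  qed
  have der_eq: "deriv (\<lambda>s. y s z) t = deriv (\<lambda>s. x s z) t" if "t > 0" "z \<in> G" for t z
    by (rule DERIV_imp_deriv[OF der[OF that]])
  have C2: "C2_on G (y t)"
    and p1: "\<And>z i. z \<in> G \<Longrightarrow> partial i (y t) z = partial i (x t) z"
    and p2: "\<And>z i j. z \<in> G \<Longrightarrow> partial i (partial j (y t)) z = partial i (partial j (x t)) z"
    if t: "t > 0" for t
  proof -
    note diff = C2_on_diff[OF G CL_D(7)[OF x t] C2_on_const[of G "- c"]]
    have eq: "y t z = x t z - - c" if "z \<in> G" for z using yx[of t z] t sub[OF that] by simp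
    note cong = C2_on_cong[where g = "y t" and h = "\<lambda>w. x t w - - c", OF G eq diff(1)]
    show "C2_on G (y t)" by (rule cong(1))
    show "partial i (y t) z = partial i (x t) z" if "z \<in> G" for z i
      using cong(2)[OF _ that] diff(2)[OF that] by (simp add: partial_const)
    show "partial i (partial j (y t)) z = partial i (partial j (x t)) z" if "z \<in> G" for z i j
      using cong(3)[OF _ that] diff(3)[OF that] by (simp add: partial_const)
  qed
  have cont: "continuous_on ({0<..} \<times> G) (\<lambda>(t, z). F t z) \<longleftrightarrow> continuous_on ({0<..} \<times> G) (\<lambda>(t, z). F' t z)"
    if "\<And>t z. t > 0 \<Longrightarrow> z \<in> G \<Longrightarrow> F t z = F' t z" for F F' :: "'n evolution"
    by (rule continuous_on_cong) (use that in auto)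
  have C12x: "C12 G x" by (rule CL_D(4)[OF x])
  have "C12 G y"
    unfolding C12_def
  proof (intro conjI allI impI ballI)
    show "(\<lambda>s. y s z) differentiable at t" if "t > 0" "z \<in> G" for t z
      unfolding real_differentiable_def by (rule exI, rule der[OF that])
    show "continuous_on ({0<..} \<times> G) (\<lambda>(t, z). deriv (\<lambda>s. y s z) t)"
      using C12x cont[of "\<lambda>t z. deriv (\<lambda>s. y s z) t" "\<lambda>t z. deriv (\<lambda>s. x s z) t"] der_eq
      by (simp add: C12_def)
    show "has_partial i (y t) z" "has_partial i (partial j (y t)) z" if "t > 0" "z \<in> G" for i j t z
      using C2[OF that(1)] that(2) by (auto simp: C2_on_def)
    show "continuous_on ({0<..} \<times> G) (\<lambda>(t, z). partial i (y t) z)" for i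
      using C12x cont[of "\<lambda>t z. partial i (y t) z" "\<lambda>t z. partial i (x t) z"] p1
      by (simp add: C12_def)
    show "continuous_on ({0<..} \<times> G) (\<lambda>(t, z). partial i (partial j (y t)) z)" for i j
      using C12x cont[of "\<lambda>t z. partial i (partial j (y t)) z" "\<lambda>t z. partial i (partial j (x t)) z"] p2
      by (simp add: C12_def)
  qed
  moreover have "continuous_on ({0..} \<times> closure G) (\<lambda>(t, z). y t z)"
  proof (rule continuous_on_eq)
    show "continuous_on ({0..} \<times> closure G) (\<lambda>p. (\<lambda>(t, z). x t z) p + c)"
      by (intro continuous_intros CL_D(3)[OF x])
  qed (auto simp: yx)
  moreover have "y \<in> {0..} \<rightarrow>\<^sub>E extensional (closure G)" by (auto simp: y_def)
  ultimately show "y \<in> CL G" unfolding CL_def by blast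
  show "t > 0 \<Longrightarrow> z \<in> G \<Longrightarrow> deriv (\<lambda>s. y s z) t = deriv (\<lambda>s. x s z) t" by (rule der_eq)
  show "t > 0 \<Longrightarrow> z \<in> G \<Longrightarrow> second_order a (y t) z = second_order a (x t) z"
    by (simp add: second_order_def p2)
  show "t > 0 \<Longrightarrow> z \<in> G \<Longrightarrow> grad (y t) z = grad (x t) z"
    by (simp add: grad_def p1)
qed

lemma DI_solution_translate:
  fixes y :: "'n::finite evolution"
  assumes G: "open G" and y: "DI_solution G a f y0 v y"
    and v: "\<And>t z. t \<ge> 0 \<Longrightarrow> z \<in> closure G \<Longrightarrow> v t z = c"
    and u: "\<And>t z. t \<ge> 0 \<Longrightarrow> z \<in> frontier G \<Longrightarrow> u t z = c"
    and x0: "\<And>z. z \<in> G \<Longrightarrow> x0 z = y0 z + c"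
  shows "BI_solution G a f x0 u (\<lambda>t\<in>{0..}. \<lambda>z\<in>closure G. y t z + c)"
proof -
  have CL: "y \<in> CL G" using y by (simp add: DI_solution_def)
  have sub: "z \<in> closure G" if "z \<in> G" for z using that closure_subset by blast
  have fr: "z \<in> closure G" if "z \<in> frontier G" for z using that by (simp add: frontier_def)
  define X where "X = (\<lambda>t\<in>{0..}. \<lambda>z\<in>closure G. y t z + c)"
  have X: "X t z = y t z + c" if "t \<ge> 0" "z \<in> closure G" for t z using that by (simp add: X_def)
  have "BI_solution G a f x0 u X"
    using y v u x0 unfolding BI_solution_def DI_solution_def L_op_def
    by (simp add: translate_CL[OF G CL, where c = c, folded X_def] X sub fr)
  then show ?thesis by (simp add: X_def)
qed

lemma BI_solution_translate:
  fixes x :: "'n::finite evolution"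
  assumes G: "open G" and x: "BI_solution G a f x0 u x"
    and v: "\<And>t z. t \<ge> 0 \<Longrightarrow> z \<in> closure G \<Longrightarrow> v t z = c"
    and u: "\<And>t z. t \<ge> 0 \<Longrightarrow> z \<in> frontier G \<Longrightarrow> u t z = c"
    and y0: "\<And>z. z \<in> G \<Longrightarrow> y0 z = x0 z + - c"
  shows "DI_solution G a f y0 v (\<lambda>t\<in>{0..}. \<lambda>z\<in>closure G. x t z + - c)"
proof -
  have CL: "x \<in> CL G" using x by (simp add: BI_solution_def)
  have sub: "z \<in> closure G" if "z \<in> G" for z using that closure_subset by blast
  have fr: "z \<in> closure G" if "z \<in> frontier G" for z using that by (simp add: frontier_def)
  define Y where "Y = (\<lambda>t\<in>{0..}. \<lambda>z\<in>closure G. x t z + - c)"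
  have Y: "Y t z = x t z + - c" if "t \<ge> 0" "z \<in> closure G" for t z using that by (simp add: Y_def)
  have "DI_solution G a f y0 v Y"
    using x v u y0 unfolding BI_solution_def DI_solution_def L_op_def
    by (simp add: translate_CL[OF G CL, where c = "- c", folded Y_def] Y sub fr)
  then show ?thesis by (simp add: Y_def)
qed

text \<open>
  Uniqueness for (DI) is inherited from (BI): adding \<open>c\<close> to any solution of (DI) gives the solution of
  (BI).
\<close>

lemma DI_flow_eq:
  fixes x :: "'n::finite evolution"
  assumes G: "open G" "bounded G" "uniformly_parabolic G a" "H2 G f"
    and x: "BI_solution G a f x0 u x"
    and v: "\<And>t z. t \<ge> 0 \<Longrightarrow> z \<in> closure G \<Longrightarrow> v t z = c"
    and u: "\<And>t z. t \<ge> 0 \<Longrightarrow> z \<in> frontier G \<Longrightarrow> u t z = c"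
    and y0: "\<And>z. z \<in> G \<Longrightarrow> y0 z = x0 z + - c"
    and t: "t \<ge> 0"
  shows "DI_flow G a f t y0 v = (\<lambda>z\<in>closure G. x t z - c)"
proof -
  let ?y = "\<lambda>t\<in>{0..}. \<lambda>z\<in>closure G. x t z + - c"
  have sol: "DI_solution G a f y0 v ?y" by (rule BI_solution_translate[OF G(1) x v u y0])
  have "y = ?y" if y: "DI_solution G a f y0 v y" for y
  proof -
    have CL: "y \<in> CL G" using y by (simp add: DI_solution_def)
    have "(\<lambda>t\<in>{0..}. \<lambda>z\<in>closure G. y t z + c) = x"
      by (rule BI_solution_unique[OF G DI_solution_translate[OF G(1) y v u] x]) (simp_all add: y0)
    then have "y t z + c = x t z" if "t \<ge> 0" "z \<in> closure G" for t z
      using that by (auto simp: fun_eq_iff restrict_def split: if_splits)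
    then have yx: "y t z = x t z - c" if "t \<ge> 0" "z \<in> closure G" for t z
      using that by (simp add: algebra_simps)
    then have "y t = ?y t" if "t \<ge> 0" for t
      using CL_D(1)[OF CL that] that by (intro extensionalityI[of _ "closure G"]) auto
    then show ?thesis by (rule extensionalityI[OF CL_D(2)[OF CL] restrict_extensional]) simp
  qed
  then have "(THE y. DI_solution G a f y0 v y) = ?y"
    by (rule the_equality[where P = "DI_solution G a f y0 v", OF sol])
  then show ?thesis using t by (simp add: DI_flow_def)
qed

section \<open>Input-to-state stability for steady boundary values\<close>

definition steady_input :: "(real^'n) set \<Rightarrow> 'n::finite profile \<Rightarrow> 'n evolution" where
  "steady_input G x0 = (\<lambda>t\<in>{0..}. \<lambda>z\<in>frontier G. x0 z)"

text \<open>
  The exp-ISS estimate of (BI) for boundary values constant in time and space. The initial state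
  determines such an input, so no set of admissible inputs occurs as a parameter.
\<close>

definition steady_exp_ISS :: "ereal \<Rightarrow> (real^'n) set \<Rightarrow> (real^'n \<Rightarrow> real^'n^'n) \<Rightarrow>
    (real^'n \<Rightarrow> real \<Rightarrow> real^'n \<Rightarrow> real) \<Rightarrow> 'n::finite profile set \<Rightarrow> bool" where
  "steady_exp_ISS p G a f X \<longleftrightarrow>
     (\<exists>M>0. \<exists>lam>0. \<exists>\<gamma>\<in>class_K_inf. \<forall>x\<in>X. \<forall>c. (\<forall>z\<in>frontier G. x z = c) \<longrightarrow>
        (\<forall>t\<ge>0. Lp_norm p G (BI_flow G a f t x (steady_input G x))
           \<le> M * exp (- lam * t) * Lp_norm p G x + \<gamma> \<bar>c\<bar>))"

lemma exp_ISS_E: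
  assumes "exp_ISS nX nU X Uad \<phi> W"
  obtains M lam \<gamma> where "M > 0 \<and> lam > 0 \<and> \<gamma> \<in> class_K_inf"
    "\<And>x u t. x \<in> X \<Longrightarrow> u \<in> Uad x \<Longrightarrow> u \<in> W \<Longrightarrow> t \<ge> 0 \<Longrightarrow>
       nX (\<phi> t x u) \<le> M * exp (- lam * t) * nX x + \<gamma> (nU u)"
proof -
  from assms obtain M lam \<gamma> where *: "M > 0" "lam > 0" "\<gamma> \<in> class_K_inf"
    "\<forall>x\<in>X. Uad x \<inter> W \<noteq> {} \<longrightarrow> (\<forall>u\<in>Uad x \<inter> W. \<forall>t\<ge>0.
       nX (\<phi> t x u) \<le> M * exp (- lam * t) * nX x + \<gamma> (nU u))"
    unfolding exp_ISS_def by (elim exE bexE conjE) (rule that)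
  show ?thesis
  proof (rule that[OF conjI[OF *(1) conjI[OF *(2,3)]]])
    fix x u t assume "x \<in> X" and u: "u \<in> Uad x" "u \<in> W" and "t \<ge> (0::real)"
    with *(4)[rule_format, of x u t] show "nX (\<phi> t x u) \<le> M * exp (- lam * t) * nX x + \<gamma> (nU u)"
      by blast
  qed
qed

lemma exp_ISS_I:
  assumes "M > 0" "lam > 0" "\<gamma> \<in> class_K_inf"
    and est: "\<And>x u t. x \<in> X \<Longrightarrow> u \<in> Uad x \<Longrightarrow> u \<in> W \<Longrightarrow> t \<ge> 0 \<Longrightarrow>
       nX (\<phi> t x u) \<le> M * exp (- lam * t) * nX x + \<gamma> (nU u)"
  shows "exp_ISS nX nU X Uad \<phi> W"
  unfolding exp_ISS_def
  by (rule exI[of _ M], rule conjI[OF assms(1)], rule exI[of _ lam], rule conjI[OF assms(2)],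
      rule bexI[OF _ assms(3)]) (use est in auto)

lemma steady_exp_ISS_E:
  assumes "steady_exp_ISS p G a f X"
  obtains M lam \<gamma> where "M > 0 \<and> lam > 0 \<and> \<gamma> \<in> class_K_inf"
    "\<And>x c t. x \<in> X \<Longrightarrow> \<forall>z\<in>frontier G. x z = c \<Longrightarrow> t \<ge> 0 \<Longrightarrow>
       Lp_norm p G (BI_flow G a f t x (steady_input G x)) \<le> M * exp (- lam * t) * Lp_norm p G x + \<gamma> \<bar>c\<bar>"
proof -
  from assms obtain M lam \<gamma> where *: "M > 0" "lam > 0" "\<gamma> \<in> class_K_inf"
    "\<forall>x\<in>X. \<forall>c. (\<forall>z\<in>frontier G. x z = c) \<longrightarrow> (\<forall>t\<ge>0.
       Lp_norm p G (BI_flow G a f t x (steady_input G x)) \<le> M * exp (- lam * t) * Lp_norm p G x + \<gamma> \<bar>c\<bar>)"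
    unfolding steady_exp_ISS_def by (elim exE bexE conjE) (rule that)
  show ?thesis by (rule that[OF conjI[OF *(1) conjI[OF *(2,3)]]]) (use *(4) in blast)
qed

lemma steady_exp_ISS_I:
  assumes "M > 0" "lam > 0" "\<gamma> \<in> class_K_inf"
    and est: "\<And>x c t. x \<in> X \<Longrightarrow> (\<And>z. z \<in> frontier G \<Longrightarrow> x z = c) \<Longrightarrow> t \<ge> 0 \<Longrightarrow>
       Lp_norm p G (BI_flow G a f t x (steady_input G x)) \<le> M * exp (- lam * t) * Lp_norm p G x + \<gamma> \<bar>c\<bar>"
  shows "steady_exp_ISS p G a f X"
  unfolding steady_exp_ISS_def
  by (rule exI[of _ M], rule conjI[OF assms(1)], rule exI[of _ lam], rule conjI[OF assms(2)],
      rule bexI[OF _ assms(3)]) (use est in auto)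

text \<open>
  Decay of an initial state of norm \<open>k\<close> to one of norm \<open>m\<close> is turned into decay from \<open>l\<close> to \<open>n\<close>, when
  both pairs differ by a translation by a constant of modulus \<open>s\<close>. Here \<open>E\<close> stands for the exponential
  factor and \<open>C\<close> for the norm of the constant 1.
\<close>

lemma decay_after_translation:
  fixes n m k l M E C s g :: real
  assumes "n \<le> 2 * m + 2 * C * s" and "m \<le> M * E * k + g" and "k \<le> 2 * l + 2 * C * s"
    and nonneg: "0 \<le> M" "0 \<le> E" "E \<le> 1" "0 \<le> C" "0 \<le> s"
  shows "n \<le> 4 * M * E * l + (2 * g + (4 * M * C + 2 * C) * s)"
proof -
  have "M * E * k \<le> M * E * (2 * l + 2 * C * s)"
    using assms by (intro mult_left_mono) auto
  also have "\<dots> = 2 * (M * E * l) + E * (2 * (M * C * s))" by (simp add: algebra_simps)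
  also have "E * (2 * (M * C * s)) \<le> 1 * (2 * (M * C * s))"
    using nonneg by (intro mult_right_mono) auto
  finally have "M * E * k \<le> 2 * (M * E * l) + 2 * (M * C * s)" by simp
  with assms(1,2) have "n \<le> 4 * (M * E * l) + 4 * (M * C * s) + 2 * g + 2 * C * s" by linarith
  also have "\<dots> = 4 * M * E * l + (2 * g + (4 * M * C + 2 * C) * s)" by (simp add: algebra_simps)
  finally show ?thesis .
qed

locale parabolic_problem =
  fixes G :: "(real^'n::finite) set"
    and a :: "real^'n \<Rightarrow> real^'n^'n"
    and f :: "real^'n \<Rightarrow> real \<Rightarrow> real^'n \<Rightarrow> real"
    and X :: "'n profile set"
    and Uad :: "'n profile \<Rightarrow> 'n evolution set"
    and p :: ereal
  assumes open_G: "open G" and bounded_G: "bounded G" and nonempty_G: "G \<noteq> {}"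
    and parabolic: "uniformly_parabolic G a"
    and H1: "H1 G a f X Uad" and H2: "H2 G f" and H3: "H3 G X"
    and p: "1 \<le> p"
begin

lemmas setting = open_G bounded_G parabolic H2
lemmas domain = open_G bounded_G nonempty_G

lemma frontier_nonempty: "frontier G \<noteq> {}"
  using nonempty_G bounded_G frontier_eq_empty not_bounded_UNIV by blast

lemma G_closure: "z \<in> G \<Longrightarrow> z \<in> closure G" and frontier_closure: "z \<in> frontier G \<Longrightarrow> z \<in> closure G"
  using closure_subset by (auto simp: frontier_def)

lemma X_continuous: "x \<in> X \<Longrightarrow> continuous_on (closure G) x"
  using H1 by (auto simp: H1_def C0_def)

lemma X_translate:
  assumes "x \<in> X"
  shows "(\<lambda>z\<in>closure G. x z + c) \<in> X"
proof -
  have add: "\<And>g h. g \<in> X \<Longrightarrow> h \<in> X \<Longrightarrow> (\<lambda>z\<in>closure G. g z + h z) \<in> X"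
    and const: "(\<lambda>z\<in>closure G. c) \<in> X"
    using H1 by (simp_all add: H1_def linear_space_def)
  have "(\<lambda>z\<in>closure G. x z + (\<lambda>z\<in>closure G. c) z) \<in> X" by (rule add[OF assms const])
  then show ?thesis by (simp cong: restrict_cong)
qed

lemma continuous_translate:
  fixes x :: "'n profile"
  assumes "continuous_on (closure G) x"
  shows "continuous_on (closure G) (\<lambda>z\<in>closure G. x z - c)"
  by (rule continuous_on_eq[OF continuous_on_diff[OF assms continuous_on_const[of "closure G" c]]]) simp

lemma solution:
  assumes "x0 \<in> X" "u \<in> Uad x0"
  obtains x where "BI_solution G a f x0 u x" "\<And>t. BI_flow G a f t x0 u = x t"
    "\<And>t. t \<ge> 0 \<Longrightarrow> continuous_on (closure G) (x t)"
proof -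
  obtain x where x: "BI_solution G a f x0 u x" using H1 assms unfolding H1_def by blast
  then have "x \<in> CL G" by (simp add: BI_solution_def)
  with x show ?thesis using that BI_flow_eq[OF setting x] CL_D(5) by blast
qed

lemma admissible:
  assumes "x0 \<in> X" "u \<in> Uad x0"
  shows "u \<in> boundary_inputs G" and "z \<in> frontier G \<Longrightarrow> u 0 z = x0 z"
proof -
  have "Uad x0 \<subseteq> {v \<in> boundary_inputs G. \<forall>z\<in>frontier G. v 0 z = x0 z}"
    using H1 assms(1) by (simp add: H1_def)
  with assms(2) have "u \<in> {v \<in> boundary_inputs G. \<forall>z\<in>frontier G. v 0 z = x0 z}" by (rule subsetD[rotated])
  then show "u \<in> boundary_inputs G" and "z \<in> frontier G \<Longrightarrow> u 0 z = x0 z" by simp_all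
qed

lemma steady_admissible:
  assumes "x0 \<in> X" "\<And>z. z \<in> frontier G \<Longrightarrow> x0 z = c"
  shows "steady_input G x0 \<in> Uad x0"
    and "t \<ge> 0 \<Longrightarrow> z \<in> frontier G \<Longrightarrow> steady_input G x0 t z = c"
    and "steady_input G x0 \<in> constant_in_time G"
    and "input_norm (frontier G) (steady_input G x0) = \<bar>c\<bar>"
proof -
  have "(\<exists>c. \<forall>z\<in>frontier G. x0 z = c)" using assms(2) by blast
  then show Uad: "steady_input G x0 \<in> Uad x0"
    using H1 assms(1) by (simp add: H1_def steady_input_def)
  show eq: "t \<ge> 0 \<Longrightarrow> z \<in> frontier G \<Longrightarrow> steady_input G x0 t z = c" for t z
    by (simp add: steady_input_def assms(2))
  show "steady_input G x0 \<in> constant_in_time G"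
    using admissible(1)[OF assms(1) Uad] eq by (simp add: constant_in_time_def)
  show "input_norm (frontier G) (steady_input G x0) = \<bar>c\<bar>"
    by (rule input_norm_const[OF frontier_nonempty eq])
qed

abbreviation N where "N \<equiv> Lp_norm p G"

lemma N_le_add_const:
  assumes "continuous_on (closure G) g" "continuous_on (closure G) h"
    and "\<And>z. z \<in> G \<Longrightarrow> \<bar>g z\<bar> \<le> \<bar>h z\<bar> + \<bar>c\<bar>"
  shows "N g \<le> 2 * N h + 2 * N (\<lambda>_. 1) * \<bar>c\<bar>"
  using Lp_norm_le_two_sum[OF domain p assms(1,2), of "\<lambda>_. c"] assms(3)
    Lp_norm_const(1)[OF domain p, of c]
  by (simp add: algebra_simps)

text \<open>
  Holding the boundary values of an initial state that is constant on the boundary is admissible by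
  \<open>H1\<close>.
\<close>

lemma steady_if_constant_in_time:
  assumes "BI_exp_ISS p G a f X Uad (constant_in_time G)"
  shows "steady_exp_ISS p G a f X"
proof -
  obtain M lam \<gamma> where pos: "M > 0 \<and> lam > 0 \<and> \<gamma> \<in> class_K_inf"
    and est: "\<And>x u t. x \<in> X \<Longrightarrow> u \<in> Uad x \<Longrightarrow> u \<in> constant_in_time G \<Longrightarrow> t \<ge> 0 \<Longrightarrow>
        N (BI_flow G a f t x u) \<le> M * exp (- lam * t) * N x + \<gamma> (input_norm (frontier G) u)"
    by (rule exp_ISS_E[OF assms[unfolded BI_exp_ISS_def]]) (rule that)
  from pos have M: "M > 0" "lam > 0" "\<gamma> \<in> class_K_inf" by auto
  show ?thesis
  proof (rule steady_exp_ISS_I[OF M])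
    fix x c t assume x: "x \<in> X" "\<And>z. z \<in> frontier G \<Longrightarrow> x z = c" and t: "t \<ge> (0::real)"
    show "N (BI_flow G a f t x (steady_input G x)) \<le> M * exp (- lam * t) * N x + \<gamma> \<bar>c\<bar>"
      using est[OF x(1) steady_admissible(1)[OF x] steady_admissible(3)[OF x] t]
        steady_admissible(4)[OF x] by simp
  qed
qed

lemma near_boundary_bound:
  assumes x: "x \<in> X" and B: "\<And>z. z \<in> frontier G \<Longrightarrow> \<bar>x z\<bar> \<le> B" and e: "e > 0"
  obtains \<delta> where "\<delta> > 0" "\<And>z. z \<in> G \<Longrightarrow> infdist z (frontier G) < \<delta> \<Longrightarrow> \<bar>x z\<bar> \<le> B + e"
proof -
  have "uniformly_continuous_on (closure G) x"
    using X_continuous[OF x] bounded_G by (intro compact_uniformly_continuous) auto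
  then obtain \<delta> where \<delta>: "\<delta> > 0"
    "\<And>z z'. z \<in> closure G \<Longrightarrow> z' \<in> closure G \<Longrightarrow> dist z' z < \<delta> \<Longrightarrow> dist (x z') (x z) < e"
    using e unfolding uniformly_continuous_on_def by metis
  show ?thesis
  proof (rule that[OF \<delta>(1)])
    fix z assume z: "z \<in> G" "infdist z (frontier G) < \<delta>"
    obtain z' where z': "z' \<in> frontier G" "infdist z (frontier G) = dist z z'"
      using infdist_attains_inf[OF frontier_closed frontier_nonempty] by blast
    then have "dist (x z) (x z') < e"
      using z by (intro \<delta>(2)) (auto simp: G_closure frontier_closure)
    with B[OF z'(1)] show "\<bar>x z\<bar> \<le> B + e" by (simp add: dist_real_def)
  qed
qed

text \<open>
  The blend \<open>(1 - k) * x + c * k\<close> from \<open>H3\<close> differs from \<open>x\<close> by \<open>k * (c - x)\<close>, and \<open>k\<close> vanishes away from the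
  boundary. Hence it lies above or below \<open>x\<close> everywhere as soon as \<open>c\<close> does so within distance \<open>\<delta>\<close> of
  the boundary.
\<close>

lemma boundary_blend:
  assumes x: "x \<in> X" and "\<delta> > 0"
  obtains w where "w \<in> X" "\<And>z. z \<in> frontier G \<Longrightarrow> w z = c"
    "\<And>z. z \<in> G \<Longrightarrow> \<bar>w z\<bar> \<le> \<bar>x z\<bar> + \<bar>c\<bar>"
    "\<And>z. z \<in> G \<Longrightarrow> (infdist z (frontier G) < \<delta> \<longrightarrow> x z \<le> c) \<Longrightarrow> x z \<le> w z"
    "\<And>z. z \<in> G \<Longrightarrow> (infdist z (frontier G) < \<delta> \<longrightarrow> c \<le> x z) \<Longrightarrow> w z \<le> x z"
proof -
  obtain k where k: "k \<in> closure G \<rightarrow> {0..1}" "\<And>z. z \<in> frontier G \<Longrightarrow> k z = 1"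
    "\<And>z. z \<in> G \<Longrightarrow> infdist z (frontier G) \<ge> \<delta> \<Longrightarrow> k z = 0"
    and wX: "(\<lambda>z\<in>closure G. (1 - k z) * x z + c * k z) \<in> X"
    using H3[unfolded H3_def, THEN spec, THEN mp, OF assms(2), THEN spec[where x = c], THEN bspec, OF x]
    by blast
  define w where "w = (\<lambda>z\<in>closure G. (1 - k z) * x z + c * k z)"
  have w: "w z = (1 - k z) * x z + c * k z" if "z \<in> closure G" for z using that by (simp add: w_def)
  have diff: "w z - x z = k z * (c - x z)" if "z \<in> closure G" for z
    by (simp add: w[OF that] algebra_simps)
  have k01: "0 \<le> k z" "k z \<le> 1" if "z \<in> G" for z using k(1) G_closure[OF that] by auto
  show ?thesis
  proof (rule that[of w])
    show "w \<in> X" using wX by (simp add: w_def)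
    show "w z = c" if "z \<in> frontier G" for z using w[OF frontier_closure[OF that]] k(2)[OF that] by simp
    show "\<bar>w z\<bar> \<le> \<bar>x z\<bar> + \<bar>c\<bar>" if "z \<in> G" for z
    proof -
      have "\<bar>w z\<bar> \<le> (1 - k z) * \<bar>x z\<bar> + \<bar>c\<bar> * k z"
        unfolding w[OF G_closure[OF that]]
        by (rule order_trans[OF abs_triangle_ineq]) (use k01[OF that] in \<open>simp add: abs_mult\<close>)
      also have "\<dots> \<le> 1 * \<bar>x z\<bar> + \<bar>c\<bar> * 1"
        using k01[OF that] by (intro add_mono mult_mono) auto
      finally show ?thesis by simp
    qed
    show "x z \<le> w z" if z: "z \<in> G" and le: "infdist z (frontier G) < \<delta> \<longrightarrow> x z \<le> c" for z
    proof (cases "infdist z (frontier G) < \<delta>")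
      case True
      then have "0 \<le> k z * (c - x z)" using k01[OF z] le by simp
      then show ?thesis using diff[OF G_closure[OF z]] by simp
    next
      case False
      then show ?thesis using diff[OF G_closure[OF z]] k(3)[OF z] by simp
    qed
    show "w z \<le> x z" if z: "z \<in> G" and le: "infdist z (frontier G) < \<delta> \<longrightarrow> c \<le> x z" for z
    proof (cases "infdist z (frontier G) < \<delta>")
      case True
      then have "k z * (c - x z) \<le> 0" using k01[OF z] le by (intro mult_nonneg_nonpos) auto
      then show ?thesis using diff[OF G_closure[OF z]] by simp
    next
      case False
      then show ?thesis using diff[OF G_closure[OF z]] k(3)[OF z] by simp
    qed
  qed
qed

text \<open>
  The comparison argument: the solution for \<open>u\<close> is enclosed between two solutions whose boundary values
  are the constants \<open>B'\<close> and \<open>- B'\<close>, with \<open>B'\<close> slightly larger than the norm of \<open>u\<close>.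
\<close>

lemma boundary_if_steady:
  assumes "steady_exp_ISS p G a f X"
  shows "BI_exp_ISS p G a f X Uad (boundary_inputs G)"
proof -
  obtain M lam \<gamma> where pos: "M > 0 \<and> lam > 0 \<and> \<gamma> \<in> class_K_inf"
    and est: "\<And>x c t. x \<in> X \<Longrightarrow> \<forall>z\<in>frontier G. x z = c \<Longrightarrow> t \<ge> 0 \<Longrightarrow>
        N (BI_flow G a f t x (steady_input G x)) \<le> M * exp (- lam * t) * N x + \<gamma> \<bar>c\<bar>"
    by (rule steady_exp_ISS_E[OF assms]) (rule that)
  from pos have M: "M > 0" "lam > 0" and \<gamma>: "\<gamma> \<in> class_K_inf" by auto
  define C where "C = N (\<lambda>_. 1)"
  have C: "C \<ge> 0" unfolding C_def by (rule Lp_norm_const(2)[OF domain p])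
  define \<gamma>' where "\<gamma>' = (\<lambda>s. 4 * \<gamma> s + (8 * M * C) * s)"
  have \<gamma>': "\<gamma>' \<in> class_K_inf" unfolding \<gamma>'_def using M C by (intro class_K_inf_affine[OF \<gamma>]) auto
  have "N (BI_flow G a f t x0 u) \<le> 8 * M * exp (- lam * t) * N x0 + \<gamma>' (input_norm (frontier G) u)"
    if x0: "x0 \<in> X" and u: "u \<in> Uad x0" and t: "t \<ge> 0" for x0 u t
  proof (rule class_K_inf_le_limit[OF \<gamma>'])
    let ?B = "input_norm (frontier G) u"
    have uB: "\<bar>u s z\<bar> \<le> ?B" if "s \<ge> 0" "z \<in> frontier G" for s z
      using input_norm_upper[OF admissible(1)[OF x0 u] that] .
    have x0B: "\<bar>x0 z\<bar> \<le> ?B" if "z \<in> frontier G" for z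
      using uB[OF order_refl that] admissible(2)[OF x0 u that] by simp
    show B0: "0 \<le> ?B" using frontier_nonempty x0B by (meson abs_ge_zero ex_in_conv order_trans)
    fix e :: real assume e: "e > 0"
    define B' where "B' = ?B + e"
    have B': "\<bar>B'\<bar> = B'" "\<bar>- B'\<bar> = B'" "B' \<ge> 0" using B0 e by (auto simp: B'_def)
    obtain \<delta> where \<delta>: "\<delta> > 0"
      "\<And>z. z \<in> G \<Longrightarrow> infdist z (frontier G) < \<delta> \<Longrightarrow> \<bar>x0 z\<bar> \<le> ?B + e"
      by (rule near_boundary_bound[OF x0 x0B e],  assumption, rule that)
    note \<delta> = \<delta>[folded B'_def]
    obtain x where x: "BI_solution G a f x0 u x" "\<And>t. BI_flow G a f t x0 u = x t"
      and xc: "\<And>t. t \<ge> 0 \<Longrightarrow> continuous_on (closure G) (x t)"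
      by (rule solution[OF x0 u]) (rule that)
    have steady: "N y \<le> M * exp (- lam * t) * (2 * N x0 + 2 * C * B') + \<gamma> B'"
      if w: "w \<in> X" "\<And>z. z \<in> frontier G \<Longrightarrow> w z = c" "\<And>z. z \<in> G \<Longrightarrow> \<bar>w z\<bar> \<le> \<bar>x0 z\<bar> + \<bar>c\<bar>"
        and c: "\<bar>c\<bar> = B'" and y: "BI_flow G a f t w (steady_input G w) = y" for w c y
    proof -
      have "N y \<le> M * exp (- lam * t) * N w + \<gamma> B'" using est[OF w(1) ballI[OF w(2)] t] c y by simp
      moreover have "N w \<le> 2 * N x0 + 2 * C * B'"
        using N_le_add_const[OF X_continuous[OF w(1)] X_continuous[OF x0] w(3)] c by (simp add: C_def)
      then have "M * exp (- lam * t) * N w \<le> M * exp (- lam * t) * (2 * N x0 + 2 * C * B')"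
        using M by (intro mult_left_mono) auto
      ultimately show ?thesis by linarith
    qed
    obtain w where w: "w \<in> X" "\<And>z. z \<in> frontier G \<Longrightarrow> w z = B'"
      "\<And>z. z \<in> G \<Longrightarrow> \<bar>w z\<bar> \<le> \<bar>x0 z\<bar> + \<bar>B'\<bar>"
      "\<And>z. z \<in> G \<Longrightarrow> (infdist z (frontier G) < \<delta> \<longrightarrow> x0 z \<le> B') \<Longrightarrow> x0 z \<le> w z"
      by (rule boundary_blend[OF x0 \<delta>(1), where c = B']) (rule that)
    obtain y where y: "BI_solution G a f w (steady_input G w) y"
      "\<And>t. BI_flow G a f t w (steady_input G w) = y t"
      and yc: "\<And>t. t \<ge> 0 \<Longrightarrow> continuous_on (closure G) (y t)"
      by (rule solution[OF w(1) steady_admissible(1)[OF w(1,2)]], assumption, rule that)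
    have upper: "x t z \<le> y t z" if "z \<in> closure G" for z
    proof (rule BI_solution_le[OF setting x(1) y(1) _ _ t that])
      show "x0 z \<le> w z" if "z \<in> G" for z using w(4)[OF that] \<delta>(2)[OF that] by fastforce
      show "u s z \<le> steady_input G w s z" if "s \<ge> 0" "z \<in> frontier G" for s z
        using uB[OF that] steady_admissible(2)[OF w(1,2) that] e by (simp add: B'_def)
    qed
    obtain w' where w': "w' \<in> X" "\<And>z. z \<in> frontier G \<Longrightarrow> w' z = - B'"
      "\<And>z. z \<in> G \<Longrightarrow> \<bar>w' z\<bar> \<le> \<bar>x0 z\<bar> + \<bar>- B'\<bar>"
      "\<And>z. z \<in> G \<Longrightarrow> (infdist z (frontier G) < \<delta> \<longrightarrow> - B' \<le> x0 z) \<Longrightarrow> w' z \<le> x0 z"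
      by (rule boundary_blend[OF x0 \<delta>(1), where c = "- B'"]) (rule that)
    obtain y' where y': "BI_solution G a f w' (steady_input G w') y'"
      "\<And>t. BI_flow G a f t w' (steady_input G w') = y' t"
      and y2c: "\<And>t. t \<ge> 0 \<Longrightarrow> continuous_on (closure G) (y' t)"
      by (rule solution[OF w'(1) steady_admissible(1)[OF w'(1,2)]], assumption, rule that)
    have lower: "y' t z \<le> x t z" if "z \<in> closure G" for z
    proof (rule BI_solution_le[OF setting y'(1) x(1) _ _ t that])
      show "w' z \<le> x0 z" if "z \<in> G" for z using w'(4)[OF that] \<delta>(2)[OF that] by fastforce
      show "steady_input G w' s z \<le> u s z" if "s \<ge> 0" "z \<in> frontier G" for s z
        using uB[OF that] steady_admissible(2)[OF w'(1,2) that] e by (simp add: B'_def)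
    qed
    have "N (x t) \<le> 2 * (N (y t) + N (y' t))" (is "_ \<le> ?rhs")
    proof (rule Lp_norm_le_two_sum[OF domain p xc[OF t] yc[OF t] y2c[OF t]])
      fix z assume "z \<in> G"
      then show "\<bar>x t z\<bar> \<le> \<bar>y t z\<bar> + \<bar>y' t z\<bar>"
        using upper[of z] lower[of z] G_closure[of z] by linarith
    qed
    also have "?rhs = 2 * N (y t) + 2 * N (y' t)" by simp
    finally have "N (x t) \<le> 2 * N (y t) + 2 * N (y' t)" .
    moreover have "N (y t) \<le> M * exp (- lam * t) * (2 * N x0 + 2 * C * B') + \<gamma> B'"
      by (rule steady[OF w(1,2,3) B'(1) y(2)])
    moreover have "N (y' t) \<le> M * exp (- lam * t) * (2 * N x0 + 2 * C * B') + \<gamma> B'"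
      by (rule steady[OF w'(1,2,3) B'(2) y'(2)])
    ultimately have "N (x t) \<le> 4 * (M * exp (- lam * t) * (2 * N x0 + 2 * C * B')) + 4 * \<gamma> B'"
      by linarith
    also have "\<dots> = 8 * M * exp (- lam * t) * N x0 + 4 * \<gamma> B' + exp (- lam * t) * (8 * M * C * B')"
      by (simp add: algebra_simps)
    also have "exp (- lam * t) * (8 * M * C * B') \<le> 1 * (8 * M * C * B')"
      using M C B' t by (intro mult_right_mono) auto
    finally show "N (BI_flow G a f t x0 u) \<le> 8 * M * exp (- lam * t) * N x0 + \<gamma>' (?B + e)"
      unfolding x(2) by (simp add: \<gamma>'_def B'_def)
  qed
  then show ?thesis
    unfolding BI_exp_ISS_def using M by (intro exp_ISS_I[OF _ M(2) \<gamma>', where M = "8 * M"]) simp_all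
qed

lemma DI_if_steady:
  assumes "steady_exp_ISS p G a f X"
  shows "DI_exp_ISS p G a f (zero_boundary G X) (distributed_inputs G)"
proof -
  obtain M lam \<gamma> where pos: "M > 0 \<and> lam > 0 \<and> \<gamma> \<in> class_K_inf"
    and est: "\<And>x c t. x \<in> X \<Longrightarrow> \<forall>z\<in>frontier G. x z = c \<Longrightarrow> t \<ge> 0 \<Longrightarrow>
        N (BI_flow G a f t x (steady_input G x)) \<le> M * exp (- lam * t) * N x + \<gamma> \<bar>c\<bar>"
    by (rule steady_exp_ISS_E[OF assms]) (rule that)
  from pos have M: "M > 0" "lam > 0" and \<gamma>: "\<gamma> \<in> class_K_inf" by auto
  define C where "C = N (\<lambda>_. 1)"
  have C: "C \<ge> 0" unfolding C_def by (rule Lp_norm_const(2)[OF domain p])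
  define \<gamma>' where "\<gamma>' = (\<lambda>s. 2 * \<gamma> s + (4 * M * C + 2 * C) * s)"
  have \<gamma>': "\<gamma>' \<in> class_K_inf" unfolding \<gamma>'_def using M C by (intro class_K_inf_affine[OF \<gamma>]) auto
  have "N (DI_flow G a f t y0 v) \<le> 4 * M * exp (- lam * t) * N y0 + \<gamma>' (input_norm (closure G) v)"
    if y0: "y0 \<in> zero_boundary G X" and v: "v \<in> distributed_inputs G" and t: "t \<ge> 0" for y0 v t
  proof -
    have "\<exists>c. \<forall>t\<ge>0. \<forall>z\<in>closure G. v t z = c" using v by (simp add: distributed_inputs_def)
    then obtain c where "\<forall>t\<ge>0. \<forall>z\<in>closure G. v t z = c" ..
    then have c: "v t z = c" if "t \<ge> 0" "z \<in> closure G" for t z using that by simp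
    have "closure G \<noteq> {}" using nonempty_G by simp
    then have vc: "input_norm (closure G) v = \<bar>c\<bar>" by (rule input_norm_const[OF _ c])
    have y0X: "y0 \<in> X" and y00: "\<And>z. z \<in> frontier G \<Longrightarrow> y0 z = 0"
      using y0 by (auto simp: zero_boundary_def)
    define x0 where "x0 = (\<lambda>z\<in>closure G. y0 z + c)"
    have x0X: "x0 \<in> X" unfolding x0_def by (rule X_translate[OF y0X])
    have x0c: "x0 z = c" if "z \<in> frontier G" for z
      using y00[OF that] frontier_closure[OF that] by (simp add: x0_def)
    obtain x where x: "BI_solution G a f x0 (steady_input G x0) x"
      "\<And>t. BI_flow G a f t x0 (steady_input G x0) = x t"
      and xc: "\<And>t. t \<ge> 0 \<Longrightarrow> continuous_on (closure G) (x t)"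
      by (rule solution[OF x0X steady_admissible(1)[OF x0X x0c]], assumption, rule that)
    have flow: "DI_flow G a f t y0 v = (\<lambda>z\<in>closure G. x t z - c)"
    proof (rule DI_flow_eq[OF setting x(1) _ _ _ t])
      show "v s z = c" if "s \<ge> 0" "z \<in> closure G" for s z by (rule c[OF that])
      show "steady_input G x0 s z = c" if "s \<ge> 0" "z \<in> frontier G" for s z
        by (rule steady_admissible(2)[OF x0X x0c that])
      show "y0 z = x0 z + - c" if "z \<in> G" for z using G_closure[OF that] by (simp add: x0_def)
    qed
    have "N (DI_flow G a f t y0 v) \<le> 2 * N (x t) + 2 * C * \<bar>c\<bar>"
      unfolding C_def flow
    proof (rule N_le_add_const[OF _ xc[OF t]])
      show "continuous_on (closure G) (\<lambda>z\<in>closure G. x t z - c)"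
        by (rule continuous_translate[OF xc[OF t]])
      show "\<bar>(\<lambda>z\<in>closure G. x t z - c) z\<bar> \<le> \<bar>x t z\<bar> + \<bar>c\<bar>" if "z \<in> G" for z
        using G_closure[OF that] by simp
    qed
    moreover have "N (x t) \<le> M * exp (- lam * t) * N x0 + \<gamma> \<bar>c\<bar>"
      using est[OF x0X ballI[OF x0c] t] x(2) by simp
    moreover have "N x0 \<le> 2 * N y0 + 2 * C * \<bar>c\<bar>"
      unfolding C_def
      by (rule N_le_add_const[OF X_continuous[OF x0X] X_continuous[OF y0X]])
        (simp add: x0_def G_closure)
    ultimately have "N (DI_flow G a f t y0 v) \<le> 4 * M * exp (- lam * t) * N y0
        + (2 * \<gamma> \<bar>c\<bar> + (4 * M * C + 2 * C) * \<bar>c\<bar>)"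
      by (rule decay_after_translation) (use M C t in simp_all)
    then show ?thesis by (simp add: vc \<gamma>'_def)
  qed
  then show ?thesis
    unfolding DI_exp_ISS_def using M by (intro exp_ISS_I[OF _ M(2) \<gamma>', where M = "4 * M"]) simp_all
qed

lemma steady_if_DI:
  assumes "DI_exp_ISS p G a f (zero_boundary G X) (distributed_inputs G)"
  shows "steady_exp_ISS p G a f X"
proof -
  obtain M lam \<gamma> where pos: "M > 0 \<and> lam > 0 \<and> \<gamma> \<in> class_K_inf"
    and est: "\<And>y v t. y \<in> zero_boundary G X \<Longrightarrow> v \<in> distributed_inputs G \<Longrightarrow> v \<in> distributed_inputs G \<Longrightarrow> t \<ge> 0 \<Longrightarrow>
        N (DI_flow G a f t y v) \<le> M * exp (- lam * t) * N y + \<gamma> (input_norm (closure G) v)"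
    by (rule exp_ISS_E[OF assms[unfolded DI_exp_ISS_def]]) (rule that)
  from pos have M: "M > 0" "lam > 0" and \<gamma>: "\<gamma> \<in> class_K_inf" by auto
  define C where "C = N (\<lambda>_. 1)"
  have C: "C \<ge> 0" unfolding C_def by (rule Lp_norm_const(2)[OF domain p])
  define \<gamma>' where "\<gamma>' = (\<lambda>s. 2 * \<gamma> s + (4 * M * C + 2 * C) * s)"
  have \<gamma>': "\<gamma>' \<in> class_K_inf" unfolding \<gamma>'_def using M C by (intro class_K_inf_affine[OF \<gamma>]) auto
  have "N (BI_flow G a f t x0 (steady_input G x0)) \<le> 4 * M * exp (- lam * t) * N x0 + \<gamma>' \<bar>c\<bar>"
    if x0X: "x0 \<in> X" and x0c: "\<And>z. z \<in> frontier G \<Longrightarrow> x0 z = c" and t: "t \<ge> 0" for x0 c t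
  proof -
    define v :: "'n evolution" where "v = (\<lambda>t\<in>{0..}. \<lambda>z\<in>closure G. c)"
    have v: "v t z = c" if "t \<ge> 0" "z \<in> closure G" for t z using that by (simp add: v_def)
    have "continuous_on ({0..} \<times> closure G) (\<lambda>(t, z). v t z)"
      by (rule continuous_on_eq[OF continuous_on_const[of _ c]]) (auto simp: v)
    moreover have "v \<in> {0..} \<rightarrow>\<^sub>E extensional (closure G)" by (auto simp: v_def)
    ultimately have v_in: "v \<in> distributed_inputs G"
      unfolding distributed_inputs_def by (intro CollectI conjI exI[of _ c]) (simp_all add: v)
    have "closure G \<noteq> {}" using nonempty_G by simp
    then have vc: "input_norm (closure G) v = \<bar>c\<bar>" by (rule input_norm_const[OF _ v])
    define y0 where "y0 = (\<lambda>z\<in>closure G. x0 z + - c)"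
    have y0X: "y0 \<in> X" unfolding y0_def by (rule X_translate[OF x0X])
    then have y0: "y0 \<in> zero_boundary G X"
      by (auto simp: zero_boundary_def y0_def frontier_closure x0c)
    obtain x where x: "BI_solution G a f x0 (steady_input G x0) x"
      "\<And>t. BI_flow G a f t x0 (steady_input G x0) = x t"
      and xc: "\<And>t. t \<ge> 0 \<Longrightarrow> continuous_on (closure G) (x t)"
      by (rule solution[OF x0X steady_admissible(1)[OF x0X x0c]], assumption, rule that)
    have flow: "DI_flow G a f t y0 v = (\<lambda>z\<in>closure G. x t z - c)"
    proof (rule DI_flow_eq[OF setting x(1) _ _ _ t])
      show "v s z = c" if "s \<ge> 0" "z \<in> closure G" for s z by (rule v[OF that])
      show "steady_input G x0 s z = c" if "s \<ge> 0" "z \<in> frontier G" for s z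
        by (rule steady_admissible(2)[OF x0X x0c that])
      show "y0 z = x0 z + - c" if "z \<in> G" for z using G_closure[OF that] by (simp add: y0_def)
    qed
    define y where "y = (\<lambda>z\<in>closure G. x t z - c)"
    have y_cont: "continuous_on (closure G) y"
      unfolding y_def by (rule continuous_translate[OF xc[OF t]])
    have "N (x t) \<le> 2 * N y + 2 * C * \<bar>c\<bar>"
      unfolding C_def by (rule N_le_add_const[OF xc[OF t] y_cont]) (simp add: y_def G_closure)
    moreover have "N y \<le> M * exp (- lam * t) * N y0 + \<gamma> \<bar>c\<bar>"
      using est[OF y0 v_in v_in t] by (simp add: flow y_def vc)
    moreover have "N y0 \<le> 2 * N x0 + 2 * C * \<bar>c\<bar>"
      unfolding C_def
      by (rule N_le_add_const[OF X_continuous[OF y0X] X_continuous[OF x0X]])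
        (simp add: y0_def G_closure)
    ultimately have "N (x t) \<le> 4 * M * exp (- lam * t) * N x0
        + (2 * \<gamma> \<bar>c\<bar> + (4 * M * C + 2 * C) * \<bar>c\<bar>)"
      by (rule decay_after_translation) (use M C t in simp_all)
    then show ?thesis by (simp add: x(2) \<gamma>'_def)
  qed
  then show ?thesis
    using M by (intro steady_exp_ISS_I[OF _ M(2) \<gamma>', where M = "4 * M"]) simp_all
qed

lemma constant_in_time_if_boundary:
  assumes "BI_exp_ISS p G a f X Uad (boundary_inputs G)"
  shows "BI_exp_ISS p G a f X Uad (constant_in_time G)"
proof -
  obtain M lam \<gamma> where pos: "M > 0 \<and> lam > 0 \<and> \<gamma> \<in> class_K_inf"
    and est: "\<And>x u t. x \<in> X \<Longrightarrow> u \<in> Uad x \<Longrightarrow> u \<in> boundary_inputs G \<Longrightarrow> t \<ge> 0 \<Longrightarrow>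
        N (BI_flow G a f t x u) \<le> M * exp (- lam * t) * N x + \<gamma> (input_norm (frontier G) u)"
    by (rule exp_ISS_E[OF assms[unfolded BI_exp_ISS_def]]) (rule that)
  from pos have M: "M > 0" "lam > 0" "\<gamma> \<in> class_K_inf" by auto
  show ?thesis
    unfolding BI_exp_ISS_def
  proof (rule exp_ISS_I[OF M])
    fix x u t assume x: "x \<in> X" and u: "u \<in> Uad x" and t: "t \<ge> (0::real)"
    show "N (BI_flow G a f t x u) \<le> M * exp (- lam * t) * N x + \<gamma> (input_norm (frontier G) u)"
      by (rule est[OF x u admissible(1)[OF x u] t])
  qed
qed

end

section \<open>Equivalence of the three stability properties\<close>

theorem mainTheorem5:
  fixes G :: "(real^'n) set"
    and a :: "real^'n \<Rightarrow> real^'n^'n"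
    and f :: "real^'n \<Rightarrow> real \<Rightarrow> real^'n \<Rightarrow> real"
    and X :: "(real^'n \<Rightarrow> real) set"
    and Uad :: "(real^'n \<Rightarrow> real) \<Rightarrow> (real \<Rightarrow> real^'n \<Rightarrow> real) set"
    and p :: ereal
  assumes "open G" and "bounded G" and "G \<noteq> {}"
    and "\<And>i j. continuous_on (closure G) (\<lambda>z. a z $ i $ j)"
    and "continuous_on (closure G \<times> UNIV \<times> UNIV) (\<lambda>(z, w, \<xi>). f z w \<xi>)"
    and "uniformly_parabolic G a"
    and "H1 G a f X Uad" and "H2 G f" and "H3 G X"
    and "1 \<le> p"
  shows "(BI_exp_ISS p G a f X Uad (boundary_inputs G)
            \<longleftrightarrow> BI_exp_ISS p G a f X Uad (constant_in_time G))
       \<and> (BI_exp_ISS p G a f X Uad (constant_in_time G)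
            \<longleftrightarrow> DI_exp_ISS p G a f (zero_boundary G X) (distributed_inputs G))"
proof -
  interpret parabolic_problem G a f X Uad p
    using assms by (simp add: parabolic_problem_def)
  show ?thesis
    using constant_in_time_if_boundary steady_if_constant_in_time boundary_if_steady
      DI_if_steady steady_if_DI by blast
qed

end
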